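(* The Grigorchuk group $\mathfrak{G}$ is densely related. In particular, no asymptotic cone of $\mathfrak{G}$ is simply connected.
   Context: The Grigorchuk group $\mathfrak{G}$ is the group of automorphisms of the rooted binary tree generated by $a,b,c,d$, where $a$ swaps the two subtrees hanging from the root, and $b,c,d$ fix the first level and are defined recursively by their actions on the two subtrees: $b=(a,c)$, $c=(a,d)$, $d=(1,b)$. For a group $G$ with a generating subset $S$, let $F_S$ be the free group on $S$ with its word length, let $N$ be the kernel of the natural map $F_S\to G$, and for $n\ge 0$ let $N_n$ be the normal subgroup of $F_S$ generated (as a normal subgroup) by the elements of $N$ of length at most $n$ ($N_{-1}$ is trivial). The relation range $\mathcal{R}_S(G)$ is the set of integers $n\ge 0$ such that $N_n$ properly contains $N_{n-1}$. A finitely generated group $G$ is densely related if, for a finite generating subset $S$, there exists $c>0$ such that for all integers $n\ge 1$ we have $\mathcal{R}_S(G)\cap[n,cn]\neq\emptyset$ (this does not depend on $S$). Asymptotic cones: for a non-principal ultrafilter $\omega$ on $\mathbf{N}$, a sequence $(x_n)$ of points of $G$ and a sequence of positive numbers $(s_n)$ with $\lim_\omega s_n=+\infty$, the asymptotic cone $\mathrm{Cone}^\omega(G,(x_n),(s_n))$ is the $\omega$-ultralimit of the pointed metric spaces $(G,\tfrac{1}{s_n}d_S,x_n)$, where $d_S$ is the word metric for a finite generating subset $S$. *)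

theory Defs
  imports "HOL-Analysis.Analysis" "HOL-Algebra.Generated_Groups"
begin

section \<open>The Grigorchuk group\<close>

text \<open>Vertices of the rooted binary tree are the finite words over \<^typ>\<open>bool\<close>; the root is the
  empty word and the two children of \<open>v\<close> are \<open>v @ [False]\<close> and \<open>v @ [True]\<close>.\<close>

definition child :: "bool list \<Rightarrow> bool list \<Rightarrow> bool" where
  "child v w \<longleftrightarrow> (\<exists>x. w = v @ [x])"

definition tree_aut :: "(bool list \<Rightarrow> bool list) monoid" where
  "tree_aut = \<lparr>carrier = {f. bij f \<and> f [] = [] \<and> (\<forall>v w. child (f v) (f w) \<longleftrightarrow> child v w)},
               mult = (\<circ>), one = id\<rparr>"

text \<open>A pair \<open>(f, g)\<close> acts by \<open>f\<close> on the subtree of words beginning with \<open>False\<close> and by \<open>g\<close> on the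
  subtree of words beginning with \<open>True\<close>: \<open>b = (a, c)\<close>, \<open>c = (a, d)\<close>, \<open>d = (1, b)\<close>.\<close>

fun grig_a :: "bool list \<Rightarrow> bool list" where
  "grig_a [] = []"
| "grig_a (x # v) = (\<not> x) # v"

fun grig_b grig_c grig_d :: "bool list \<Rightarrow> bool list" where
  "grig_b [] = []"
| "grig_b (False # v) = False # grig_a v"
| "grig_b (True # v) = True # grig_c v"
| "grig_c [] = []"
| "grig_c (False # v) = False # grig_a v"
| "grig_c (True # v) = True # grig_d v"
| "grig_d [] = []"
| "grig_d (False # v) = False # v"
| "grig_d (True # v) = True # grig_b v"

definition grigorchuk_group :: "(bool list \<Rightarrow> bool list) monoid" where
  "grigorchuk_group =
     tree_aut\<lparr>carrier := generate tree_aut {grig_a, grig_b, grig_c, grig_d}\<rparr>"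

lemma group_tree_aut: "group tree_aut"
proof (rule groupI)
  fix f assume f: "f \<in> carrier tree_aut"
  then have bf: "bij f" by (simp add: tree_aut_def)
  have e: "f (inv_into UNIV f v) = v" "inv_into UNIV f (f v) = v" for v
    using bf by (simp_all add: bij_is_surj surj_f_inv_f bij_is_inj)
  have "inv_into UNIV f \<in> carrier tree_aut"
    using f e unfolding tree_aut_def
    by (auto simp: bij_imp_bij_inv) (metis e)+
  moreover have "inv_into UNIV f \<otimes>\<^bsub>tree_aut\<^esub> f = \<one>\<^bsub>tree_aut\<^esub>"
    using e by (simp add: tree_aut_def fun_eq_iff)
  ultimately show "\<exists>g\<in>carrier tree_aut. g \<otimes>\<^bsub>tree_aut\<^esub> f = \<one>\<^bsub>tree_aut\<^esub>"
    by blast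
qed (auto simp: tree_aut_def bij_comp comp_assoc)

lemma tree_aut_involutionI:
  assumes inv: "\<And>v. f (f v) = v" and len: "\<And>v. length (f v) = length v"
    and pre: "\<And>v x. \<exists>y. f (v @ [x]) = f v @ [y]"
  shows "f \<in> carrier tree_aut"
proof -
  have 1: "child (f v) (f w)" if "child v w" for v w
    using that pre unfolding child_def by blast
  have 2: "child (f v) (f w) \<longleftrightarrow> child v w" for v w
    using 1[of v w] 1[of "f v" "f w"] by (auto simp: inv)
  show ?thesis
    using 2 len[of "[]"] inv by (auto simp: tree_aut_def intro!: o_bij[of f f])
qed

lemma grig_in_tree_aut: "{grig_a, grig_b, grig_c, grig_d} \<subseteq> carrier tree_aut"
proof -
  have ia: "grig_a (grig_a v) = v" for v by (cases v) auto
  have la: "length (grig_a v) = length v" for v by (cases v) auto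
  have pa: "\<exists>y. grig_a (v @ [x]) = grig_a v @ [y]" for v x by (cases v) auto
  have i: "grig_b (grig_b v) = v \<and> grig_c (grig_c v) = v \<and> grig_d (grig_d v) = v" for v
  proof (induction v)
    case (Cons x v) then show ?case by (cases x) (auto simp: ia)
  qed simp
  have l: "length (grig_b v) = length v \<and> length (grig_c v) = length v \<and>
           length (grig_d v) = length v" for v
  proof (induction v)
    case (Cons x v) then show ?case by (cases x) (auto simp: la)
  qed simp
  have p: "(\<exists>y. grig_b (v @ [x]) = grig_b v @ [y]) \<and> (\<exists>y. grig_c (v @ [x]) = grig_c v @ [y]) \<and>
           (\<exists>y. grig_d (v @ [x]) = grig_d v @ [y])" for v x
  proof (induction v)
    case Nil then show ?case by (cases x) auto
  next
    case (Cons z v) then show ?case using pa[of v x] by (cases z) auto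
  qed
  show ?thesis
    using ia la pa i l p by (auto intro!: tree_aut_involutionI)
qed

lemma group_grigorchuk_group: "group grigorchuk_group"
  unfolding grigorchuk_group_def
  by (intro subgroup.subgroup_is_group group.generate_is_subgroup group_tree_aut grig_in_tree_aut)

section \<open>Free groups and the natural map to a group\<close>

text \<open>The letter \<open>(s, True)\<close> stands for \<open>s\<close> and \<open>(s, False)\<close> for its formal inverse. Elements of the
  free group on \<open>S\<close> are the reduced words, so the word length of an element is its length as a
  list, and the product of two reduced words is the reduced form of their concatenation.\<close>

type_synonym 'a letter = "'a \<times> bool"

definition inv_letter :: "'a letter \<Rightarrow> 'a letter" where
  "inv_letter x = (fst x, \<not> snd x)"

fun reduced_word :: "'a letter list \<Rightarrow> bool" where
  "reduced_word [] \<longleftrightarrow> True"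
| "reduced_word [x] \<longleftrightarrow> True"
| "reduced_word (x # y # w) \<longleftrightarrow> y \<noteq> inv_letter x \<and> reduced_word (y # w)"

fun red_cons :: "'a letter \<Rightarrow> 'a letter list \<Rightarrow> 'a letter list" where
  "red_cons x [] = [x]"
| "red_cons x (y # w) = (if y = inv_letter x then w else x # y # w)"

definition free_group :: "'a set \<Rightarrow> 'a letter list monoid" where
  "free_group S = \<lparr>carrier = {w. reduced_word w \<and> fst ` set w \<subseteq> S},
                   mult = (\<lambda>u v. foldr red_cons u v), one = []\<rparr>"

definition eval_letter :: "('a, 'm) monoid_scheme \<Rightarrow> 'a letter \<Rightarrow> 'a" where
  "eval_letter G x = (if snd x then fst x else inv\<^bsub>G\<^esub> fst x)"

definition eval_word :: "('a, 'm) monoid_scheme \<Rightarrow> 'a letter list \<Rightarrow> 'a" where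
  "eval_word G w = foldr (\<lambda>x g. eval_letter G x \<otimes>\<^bsub>G\<^esub> g) w \<one>\<^bsub>G\<^esub>"

lemma inv_letter_inv_letter [simp]: "inv_letter (inv_letter x) = x"
  by (simp add: inv_letter_def)

lemma fst_inv_letter [simp]: "fst (inv_letter x) = fst x"
  by (simp add: inv_letter_def)

lemma inv_letter_neq [simp]: "inv_letter x \<noteq> x" "x \<noteq> inv_letter x"
  by (auto simp: inv_letter_def prod_eq_iff)

lemma reduced_tl: "reduced_word (x # w) \<Longrightarrow> reduced_word w"
  by (cases w) auto

lemma reduced_red_cons: "reduced_word w \<Longrightarrow> reduced_word (red_cons x w)"
  by (cases w) (auto dest: reduced_tl)

lemma reduced_foldr: "reduced_word v \<Longrightarrow> reduced_word (foldr red_cons u v)"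
  by (induction u) (auto intro: reduced_red_cons)

lemma red_cons_cancel: "reduced_word w \<Longrightarrow> red_cons x (red_cons (inv_letter x) w) = w"
  by (cases "(inv_letter x, w)" rule: red_cons.cases; cases "tl w") auto

lemma red_cons_reduced: "reduced_word (x # w) \<Longrightarrow> red_cons x w = x # w"
  by (cases w) auto

lemma foldr_red_cons_Nil: "reduced_word u \<Longrightarrow> foldr red_cons u [] = u"
proof (induction u)
  case (Cons x u)
  with reduced_tl[of x u] red_cons_reduced[of x u] show ?case by simp
qed simp

lemma foldr_red_cons_red_cons:
  assumes "reduced_word w"
  shows "foldr red_cons (red_cons x u) w = red_cons x (foldr red_cons u w)"
proof (cases u)
  case (Cons y t)
  then show ?thesis
    using red_cons_cancel[OF reduced_foldr[OF assms], of x t] by simp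
qed simp

lemma foldr_red_cons_assoc:
  "reduced_word w \<Longrightarrow> foldr red_cons (foldr red_cons u v) w = foldr red_cons u (foldr red_cons v w)"
  by (induction u) (auto simp: foldr_red_cons_red_cons)

lemma set_foldr_red_cons: "set (foldr red_cons u v) \<subseteq> set u \<union> set v"
proof (induction u)
  case (Cons x u)
  have "set (red_cons x w) \<subseteq> insert x (set w)" for w
    by (cases w) auto
  from this[of "foldr red_cons u v"] Cons show ?case by auto
qed simp

lemma foldr_red_cons_rev_inv:
  "reduced_word u \<Longrightarrow> foldr red_cons (rev (map inv_letter u)) u = []"
proof (induction u)
  case (Cons x u)
  have "red_cons (inv_letter x) (x # u) = u" by simp
  with Cons show ?case by (auto dest: reduced_tl)
qed simp

lemma reduced_append:
  "reduced_word (u @ [x]) \<longleftrightarrow> reduced_word u \<and> (u = [] \<or> x \<noteq> inv_letter (last u))"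
  by (induction u rule: reduced_word.induct) auto

lemma reduced_rev_inv: "reduced_word u \<Longrightarrow> reduced_word (rev (map inv_letter u))"
proof (induction u rule: reduced_word.induct)
  case (3 x y w)
  then have "reduced_word (rev (map inv_letter w) @ [inv_letter y])" "y \<noteq> inv_letter x" by auto
  moreover have "inv_letter x \<noteq> y" using \<open>y \<noteq> inv_letter x\<close> by blast
  ultimately show ?case
    using reduced_append[of "rev (map inv_letter w) @ [inv_letter y]" "inv_letter x"] by simp
qed auto

lemma group_free_group: "group (free_group S)"
proof (rule groupI)
  fix u assume u: "u \<in> carrier (free_group S)"
  then have "rev (map inv_letter u) \<in> carrier (free_group S)"
    by (auto simp: free_group_def intro: reduced_rev_inv)
  then show "\<exists>v\<in>carrier (free_group S). v \<otimes>\<^bsub>free_group S\<^esub> u = \<one>\<^bsub>free_group S\<^esub>"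
    using u by (intro bexI[of _ "rev (map inv_letter u)"])
      (auto simp: free_group_def foldr_red_cons_rev_inv)
next
  fix u v assume "u \<in> carrier (free_group S)" "v \<in> carrier (free_group S)"
  then show "u \<otimes>\<^bsub>free_group S\<^esub> v \<in> carrier (free_group S)"
    using image_mono[OF set_foldr_red_cons[of u v], of fst]
    by (simp add: free_group_def reduced_foldr image_Un) blast
qed (auto simp: free_group_def foldr_red_cons_assoc)

lemma eval_word_hom:
  assumes "group G" "S \<subseteq> carrier G"
  shows "eval_word G \<in> hom (free_group S) G"
proof -
  interpret group G by fact
  have el: "eval_letter G x \<in> carrier G" if "fst x \<in> S" for x
    using that assms(2) by (auto simp: eval_letter_def)
  have ew: "eval_word G w \<in> carrier G" if "fst ` set w \<subseteq> S" for w
    using that by (induction w) (auto simp: eval_word_def el)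
  have ei: "eval_letter G x \<otimes>\<^bsub>G\<^esub> eval_letter G (inv_letter x) = \<one>\<^bsub>G\<^esub>" if "fst x \<in> S" for x
    using that assms(2) by (auto simp: eval_letter_def inv_letter_def)
  have ec: "eval_word G (x # w) = eval_letter G x \<otimes>\<^bsub>G\<^esub> eval_word G w" for x w
    by (simp add: eval_word_def)
  have rc: "eval_word G (red_cons x w) = eval_letter G x \<otimes>\<^bsub>G\<^esub> eval_word G w"
    if "fst x \<in> S" "fst ` set w \<subseteq> S" for x w
  proof (cases w)
    case Nil then show ?thesis by (simp add: eval_word_def)
  next
    case (Cons y t)
    then show ?thesis
      using that ei[of x] el ew[of t]
      by (auto simp: ec m_assoc[symmetric])
  qed
  have "eval_word G (foldr red_cons u v) = eval_word G u \<otimes>\<^bsub>G\<^esub> eval_word G v"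
    if "fst ` set u \<subseteq> S" "fst ` set v \<subseteq> S" for u v
    using that
  proof (induction u)
    case Nil then show ?case by (simp add: eval_word_def) (simp add: ew flip: eval_word_def)
  next
    case (Cons x u)
    have "fst ` set (foldr red_cons u v) \<subseteq> S"
      using image_mono[OF set_foldr_red_cons[of u v], of fst] Cons.prems
      by (simp add: image_Un) blast
    with Cons show ?case
      by (simp add: rc ec m_assoc el ew)
  qed
  then show ?thesis
    by (auto simp: hom_def free_group_def ew)
qed

lemma eval_word_surj:
  assumes "group G" "S \<subseteq> carrier G" "generate G S = carrier G"
  shows "eval_word G ` carrier (free_group S) = carrier G"
proof -
  interpret group_hom "free_group S" G "eval_word G"
    by (simp add: group_hom_def group_hom_axioms_def assms group_free_group eval_word_hom)
  have "s \<in> eval_word G ` carrier (free_group S)" if "s \<in> S" for s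
    using that assms(2)
    by (intro image_eqI[of _ _ "[(s, True)]"])
      (auto simp: free_group_def eval_word_def eval_letter_def)
  then have "generate G S \<subseteq> eval_word G ` carrier (free_group S)"
    by (intro H.generate_subgroup_incl img_is_subgroup) auto
  then show ?thesis using assms(3) hom_closed by auto
qed

lemma length_foldr_red_cons: "length (foldr red_cons u v) \<le> length u + length v"
proof (induction u)
  case (Cons x u)
  have "length (red_cons x w) \<le> Suc (length w)" for w by (cases w) auto
  from this[of "foldr red_cons u v"] Cons show ?case by simp
qed simp

lemma inv_free_group:
  assumes "u \<in> carrier (free_group S)"
  shows "inv\<^bsub>free_group S\<^esub> u = rev (map inv_letter u)"
proof (rule group.inv_equality[OF group_free_group])
  show "rev (map inv_letter u) \<otimes>\<^bsub>free_group S\<^esub> u = \<one>\<^bsub>free_group S\<^esub>"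
    using assms by (simp add: free_group_def foldr_red_cons_rev_inv)
  show "rev (map inv_letter u) \<in> carrier (free_group S)"
    using assms by (auto simp: free_group_def intro: reduced_rev_inv)
qed (rule assms)

section \<open>Relation range and densely related groups\<close>

definition normal_closure :: "('a, 'm) monoid_scheme \<Rightarrow> 'a set \<Rightarrow> 'a set" where
  "normal_closure G A = \<Inter>{H. H \<lhd> G \<and> A \<subseteq> H}"

definition relators_upto :: "('a, 'm) monoid_scheme \<Rightarrow> 'a set \<Rightarrow> int \<Rightarrow> 'a letter list set" where
  "relators_upto G S n =
     normal_closure (free_group S)
       {w \<in> kernel (free_group S) G (eval_word G). int (length w) \<le> n}"

definition relation_range :: "('a, 'm) monoid_scheme \<Rightarrow> 'a set \<Rightarrow> int set" where
  "relation_range G S = {n. 0 \<le> n \<and> relators_upto G S (n - 1) \<subset> relators_upto G S n}"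

definition finite_generating_set :: "('a, 'm) monoid_scheme \<Rightarrow> 'a set \<Rightarrow> bool" where
  "finite_generating_set G S \<longleftrightarrow> finite S \<and> S \<subseteq> carrier G \<and> generate G S = carrier G"

text \<open>The property does not depend on the finite generating set \<open>S\<close>, so one such set is asked for;
  its existence also expresses that \<open>G\<close> is finitely generated.\<close>

definition densely_related :: "('a, 'm) monoid_scheme \<Rightarrow> bool" where
  "densely_related G \<longleftrightarrow>
     (\<exists>S. finite_generating_set G S \<and>
       (\<exists>c::real. c > 0 \<and>
         (\<forall>n::int. n \<ge> 1 \<longrightarrow>
           (\<exists>m\<in>relation_range G S. n \<le> m \<and> real_of_int m \<le> c * real_of_int n))))"

lemma relators_upto_minus_one: "relators_upto G S (-1) = {\<one>\<^bsub>free_group S\<^esub>}"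
proof -
  interpret group "free_group S" by (rule group_free_group)
  have "{w \<in> kernel (free_group S) G (eval_word G). int (length w) \<le> -1} = {}" by auto
  moreover have "\<one>\<^bsub>free_group S\<^esub> \<in> H" if "H \<lhd> free_group S" for H
    using normal_imp_subgroup[OF that] by (rule subgroup.one_closed)
  ultimately show ?thesis
    using one_is_normal by (auto simp: relators_upto_def normal_closure_def)
qed

section \<open>Asymptotic cones\<close>

definition word_length :: "('a, 'm) monoid_scheme \<Rightarrow> 'a set \<Rightarrow> 'a \<Rightarrow> nat" where
  "word_length G S g =
     (LEAST n. \<exists>w\<in>carrier (free_group S). eval_word G w = g \<and> length w = n)"

definition word_dist :: "('a, 'm) monoid_scheme \<Rightarrow> 'a set \<Rightarrow> 'a \<Rightarrow> 'a \<Rightarrow> real" where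
  "word_dist G S g h = real (word_length G S (inv\<^bsub>G\<^esub> g \<otimes>\<^bsub>G\<^esub> h))"

lemma word_dist_props:
  assumes "group G" and S: "finite_generating_set G S"
  shows "\<And>g. g \<in> carrier G \<Longrightarrow> word_dist G S g g = 0"
    and "\<And>g h. g \<in> carrier G \<Longrightarrow> h \<in> carrier G \<Longrightarrow> word_dist G S g h = word_dist G S h g"
    and "\<And>g h k. g \<in> carrier G \<Longrightarrow> h \<in> carrier G \<Longrightarrow> k \<in> carrier G \<Longrightarrow>
           word_dist G S g k \<le> word_dist G S g h + word_dist G S h k"
proof -
  have SG: "S \<subseteq> carrier G" "generate G S = carrier G"
    using S by (auto simp: finite_generating_set_def)
  interpret group_hom "free_group S" G "eval_word G"
    by (simp add: group_hom_def group_hom_axioms_def assms(1) SG group_free_group eval_word_hom)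
  have le: "word_length G S (eval_word G w) \<le> length w" if "w \<in> carrier (free_group S)" for w
    unfolding word_length_def using that by (intro Least_le) blast
  have ex: "\<exists>w\<in>carrier (free_group S). eval_word G w = g \<and> length w = word_length G S g"
    if "g \<in> carrier G" for g
  proof -
    have "\<exists>n. \<exists>w\<in>carrier (free_group S). eval_word G w = g \<and> length w = n"
      using eval_word_surj[OF assms(1) SG] that by (metis imageE)
    then show ?thesis unfolding word_length_def by (rule LeastI_ex)
  qed
  have mult: "word_length G S (g \<otimes>\<^bsub>G\<^esub> h) \<le> word_length G S g + word_length G S h"
    if gh: "g \<in> carrier G" "h \<in> carrier G" for g h
  proof -
    obtain u v where u: "u \<in> carrier (free_group S)" "eval_word G u = g" "length u = word_length G S g"
      and v: "v \<in> carrier (free_group S)" "eval_word G v = h" "length v = word_length G S h"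
      using ex gh by metis
    have "word_length G S (g \<otimes>\<^bsub>G\<^esub> h) \<le> length (u \<otimes>\<^bsub>free_group S\<^esub> v)"
      using le[of "u \<otimes>\<^bsub>free_group S\<^esub> v"] u v by (simp add: hom_mult)
    also have "\<dots> \<le> length u + length v"
      by (simp add: free_group_def length_foldr_red_cons)
    finally show ?thesis using u v by simp
  qed
  have inv: "word_length G S (inv\<^bsub>G\<^esub> g) \<le> word_length G S g" if g: "g \<in> carrier G" for g
  proof -
    obtain u where u: "u \<in> carrier (free_group S)" "eval_word G u = g" "length u = word_length G S g"
      using ex g by metis
    have "length (inv\<^bsub>free_group S\<^esub> u) = length u"
      using u by (simp add: inv_free_group)
    then show ?thesis
      using le[of "inv\<^bsub>free_group S\<^esub> u"] u hom_inv[of u] by simp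
  qed
  show "word_dist G S g g = 0" if "g \<in> carrier G" for g
    using that le[of "\<one>\<^bsub>free_group S\<^esub>"] by (simp add: word_dist_def) (simp add: free_group_def)
  have sym: "word_length G S (inv\<^bsub>G\<^esub> g \<otimes>\<^bsub>G\<^esub> h) \<le> word_length G S (inv\<^bsub>G\<^esub> h \<otimes>\<^bsub>G\<^esub> g)"
    if "g \<in> carrier G" "h \<in> carrier G" for g h
    using inv[of "inv\<^bsub>G\<^esub> h \<otimes>\<^bsub>G\<^esub> g"] that by (simp add: H.inv_mult_group)
  show "word_dist G S g h = word_dist G S h g" if "g \<in> carrier G" "h \<in> carrier G" for g h
    using sym[of g h] sym[of h g] that by (simp add: word_dist_def)
  show "word_dist G S g k \<le> word_dist G S g h + word_dist G S h k"
    if "g \<in> carrier G" "h \<in> carrier G" "k \<in> carrier G" for g h k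
  proof -
    have "h \<otimes>\<^bsub>G\<^esub> (inv\<^bsub>G\<^esub> h \<otimes>\<^bsub>G\<^esub> k) = k"
      using that H.m_assoc[of h "inv\<^bsub>G\<^esub> h" k, symmetric]
      by (simp only: H.inv_closed H.r_inv H.l_one)
    then have "(inv\<^bsub>G\<^esub> g \<otimes>\<^bsub>G\<^esub> h) \<otimes>\<^bsub>G\<^esub> (inv\<^bsub>G\<^esub> h \<otimes>\<^bsub>G\<^esub> k) = inv\<^bsub>G\<^esub> g \<otimes>\<^bsub>G\<^esub> k"
      using that by (simp add: H.m_assoc)
    then show ?thesis
      using mult[of "inv\<^bsub>G\<^esub> g \<otimes>\<^bsub>G\<^esub> h" "inv\<^bsub>G\<^esub> h \<otimes>\<^bsub>G\<^esub> k"] that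
      by (simp add: word_dist_def flip: of_nat_add)
  qed
qed

text \<open>Ultrafilters on the natural numbers are encoded as filters; a set \<open>A\<close> belongs to \<open>\<omega>\<close>
  iff \<open>eventually (\<lambda>n. n \<in> A) \<omega>\<close>.\<close>

definition nonprincipal_ultrafilter :: "nat filter \<Rightarrow> bool" where
  "nonprincipal_ultrafilter \<omega> \<longleftrightarrow>
     \<omega> \<noteq> bot \<and> (\<forall>P. eventually P \<omega> \<or> eventually (\<lambda>n. \<not> P n) \<omega>) \<and>
     (\<forall>k. \<not> eventually (\<lambda>n. n = k) \<omega>)"

text \<open>The ultralimit of the pointed metric spaces \<open>(M n, d n, x n)\<close>: sequences at \<open>\<omega>\<close>-bounded
  distance from the base points, modulo being at \<open>\<omega>\<close>-limit distance zero. The value of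
  \<open>ultralimit_dist\<close> outside the carrier is irrelevant; it is 0 so that
  \<^locale>\<open>Metric_space\<close>, which wants a distance that is total, nonnegative and symmetric, applies.\<close>

definition ultralimit_seqs ::
  "nat filter \<Rightarrow> (nat \<Rightarrow> 'a set) \<Rightarrow> (nat \<Rightarrow> 'a \<Rightarrow> 'a \<Rightarrow> real) \<Rightarrow> (nat \<Rightarrow> 'a) \<Rightarrow> (nat \<Rightarrow> 'a) set" where
  "ultralimit_seqs \<omega> M d x =
     {y. (\<forall>n. y n \<in> M n) \<and> (\<exists>C. eventually (\<lambda>n. d n (x n) (y n) \<le> C) \<omega>)}"

definition ultralimit_rel ::
  "nat filter \<Rightarrow> (nat \<Rightarrow> 'a set) \<Rightarrow> (nat \<Rightarrow> 'a \<Rightarrow> 'a \<Rightarrow> real) \<Rightarrow> (nat \<Rightarrow> 'a) \<Rightarrow> (nat \<Rightarrow> 'a) rel" where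
  "ultralimit_rel \<omega> M d x =
     {(y, z). y \<in> ultralimit_seqs \<omega> M d x \<and> z \<in> ultralimit_seqs \<omega> M d x \<and>
        ((\<lambda>n. d n (y n) (z n)) \<longlongrightarrow> 0) \<omega>}"

definition ultralimit ::
  "nat filter \<Rightarrow> (nat \<Rightarrow> 'a set) \<Rightarrow> (nat \<Rightarrow> 'a \<Rightarrow> 'a \<Rightarrow> real) \<Rightarrow> (nat \<Rightarrow> 'a) \<Rightarrow> (nat \<Rightarrow> 'a) set set" where
  "ultralimit \<omega> M d x = ultralimit_seqs \<omega> M d x // ultralimit_rel \<omega> M d x"

definition ultralimit_dist ::
  "nat filter \<Rightarrow> (nat \<Rightarrow> 'a set) \<Rightarrow> (nat \<Rightarrow> 'a \<Rightarrow> 'a \<Rightarrow> real) \<Rightarrow> (nat \<Rightarrow> 'a) \<Rightarrow>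
     (nat \<Rightarrow> 'a) set \<Rightarrow> (nat \<Rightarrow> 'a) set \<Rightarrow> real" where
  "ultralimit_dist \<omega> M d x A B =
     (if A \<in> ultralimit \<omega> M d x \<and> B \<in> ultralimit \<omega> M d x
      then THE r. \<exists>y\<in>A. \<exists>z\<in>B. ((\<lambda>n. d n (y n) (z n)) \<longlongrightarrow> r) \<omega>
      else 0)"

lemma ultrafilter_bounded_tendsto:
  fixes f :: "nat \<Rightarrow> real"
  assumes "nonprincipal_ultrafilter \<omega>" and "eventually (\<lambda>n. f n \<in> {a..b}) \<omega>"
  shows "\<exists>l. (f \<longlongrightarrow> l) \<omega>"
proof -
  have ne: "filtermap f \<omega> \<noteq> bot" and u: "\<And>P. eventually P \<omega> \<or> eventually (\<lambda>n. \<not> P n) \<omega>"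
    using assms(1) by (auto simp: nonprincipal_ultrafilter_def filtermap_bot_iff)
  have "eventually (\<lambda>y. y \<in> {a..b}) (filtermap f \<omega>)"
    using assms(2) by (simp add: eventually_filtermap)
  then obtain l where l: "inf (nhds l) (filtermap f \<omega>) \<noteq> bot"
    using ne compact_Icc[of a b] unfolding compact_filter by blast
  have "(f \<longlongrightarrow> l) \<omega>"
  proof (rule topological_tendstoI)
    fix U assume U: "open U" "l \<in> U"
    show "eventually (\<lambda>n. f n \<in> U) \<omega>"
    proof (rule ccontr)
      assume "\<not> ?thesis"
      then have "eventually (\<lambda>y. y \<notin> U) (filtermap f \<omega>)"
        using u[of "\<lambda>n. f n \<in> U"] by (simp add: eventually_filtermap)
      moreover have "eventually (\<lambda>y. y \<in> U) (nhds l)"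
        using U by (simp add: eventually_nhds_in_open)
      ultimately have "eventually (\<lambda>y. False) (inf (nhds l) (filtermap f \<omega>))"
        unfolding eventually_inf by blast
      then show False using l by (simp add: trivial_limit_def)
    qed
  qed
  then show ?thesis ..
qed

text \<open>It suffices that the \<open>d n\<close> are pseudometrics.\<close>

lemma Metric_space_ultralimit:
  assumes \<omega>: "nonprincipal_ultrafilter \<omega>"
    and x: "\<And>n. x n \<in> M n"
    and nn: "\<And>n u v. u \<in> M n \<Longrightarrow> v \<in> M n \<Longrightarrow> 0 \<le> d n u v"
    and d0: "\<And>n u. u \<in> M n \<Longrightarrow> d n u u = 0"
    and sym: "\<And>n u v. u \<in> M n \<Longrightarrow> v \<in> M n \<Longrightarrow> d n u v = d n v u"
    and tri: "\<And>n u v w. u \<in> M n \<Longrightarrow> v \<in> M n \<Longrightarrow> w \<in> M n \<Longrightarrow> d n u w \<le> d n u v + d n v w"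
  shows "Metric_space (ultralimit \<omega> M d x) (ultralimit_dist \<omega> M d x)"
    and "ultralimit \<omega> M d x \<noteq> {}"
proof -
  let ?Q = "ultralimit_seqs \<omega> M d x" and ?R = "ultralimit_rel \<omega> M d x"
  let ?D = "ultralimit_dist \<omega> M d x" and ?U = "ultralimit \<omega> M d x"
  have ne: "\<omega> \<noteq> bot" using \<omega> by (simp add: nonprincipal_ultrafilter_def)
  have mem: "y n \<in> M n" if "y \<in> ?Q" for y n
    using that by (simp add: ultralimit_seqs_def)
  have lim: "\<exists>r. ((\<lambda>n. d n (y n) (z n)) \<longlongrightarrow> r) \<omega>" if yz: "y \<in> ?Q" "z \<in> ?Q" for y z
  proof -
    obtain C C' where "eventually (\<lambda>n. d n (x n) (y n) \<le> C) \<omega>"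
        "eventually (\<lambda>n. d n (x n) (z n) \<le> C') \<omega>"
      using yz by (auto simp: ultralimit_seqs_def)
    then have "eventually (\<lambda>n. d n (y n) (z n) \<in> {0..C + C'}) \<omega>"
    proof eventually_elim
      case (elim n)
      then show ?case
        using tri[OF mem[OF yz(1)] x mem[OF yz(2)], of n] sym[OF mem[OF yz(1)] x, of n]
          nn[OF mem[OF yz(1)] mem[OF yz(2)], of n] by auto
    qed
    with \<omega> show ?thesis by (rule ultrafilter_bounded_tendsto)
  qed
  have lim0: "0 \<le> r" if "y \<in> ?Q" "z \<in> ?Q" "((\<lambda>n. d n (y n) (z n)) \<longlongrightarrow> r) \<omega>" for y z r
    by (rule tendsto_lowerbound[OF that(3) _ ne]) (simp add: that(1,2) nn mem)
  have limtri: "r \<le> s + t"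
    if "y \<in> ?Q" "z \<in> ?Q" "w \<in> ?Q" "((\<lambda>n. d n (y n) (w n)) \<longlongrightarrow> r) \<omega>"
      "((\<lambda>n. d n (y n) (z n)) \<longlongrightarrow> s) \<omega>" "((\<lambda>n. d n (z n) (w n)) \<longlongrightarrow> t) \<omega>" for y z w r s t
    by (rule tendsto_le[OF ne tendsto_add[OF that(5,6)] that(4)])
      (simp add: that(1-3) tri mem)
  have limsym: "((\<lambda>n. d n (z n) (y n)) \<longlongrightarrow> r) \<omega>"
    if "y \<in> ?Q" "z \<in> ?Q" "((\<lambda>n. d n (y n) (z n)) \<longlongrightarrow> r) \<omega>" for y z r
    using that(3) by (simp add: sym[OF mem[OF that(1)] mem[OF that(2)]])
  have eq: "equiv ?Q ?R"
  proof (rule equivI)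
    show "?R \<subseteq> ?Q \<times> ?Q" by (auto simp: ultralimit_rel_def)
    show "refl_on ?Q ?R"
      by (auto simp: refl_on_def ultralimit_rel_def d0 mem)
    show "Relation.sym ?R"
      by (rule symI) (simp add: ultralimit_rel_def limsym)
    show "trans ?R"
    proof (rule transI)
      fix y z w assume yz: "(y, z) \<in> ?R" "(z, w) \<in> ?R"
      then have Q: "y \<in> ?Q" "z \<in> ?Q" "w \<in> ?Q" by (auto simp: ultralimit_rel_def)
      obtain r where r: "((\<lambda>n. d n (y n) (w n)) \<longlongrightarrow> r) \<omega>" using lim[OF Q(1,3)] ..
      have z: "((\<lambda>n. d n (y n) (z n)) \<longlongrightarrow> 0) \<omega>" "((\<lambda>n. d n (z n) (w n)) \<longlongrightarrow> 0) \<omega>"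
        using yz by (simp_all add: ultralimit_rel_def)
      have "r \<le> 0 + 0" by (rule limtri[OF Q r z])
      with lim0[OF Q(1,3) r] have "r = 0" by simp
      with r Q show "(y, w) \<in> ?R" by (simp add: ultralimit_rel_def)
    qed
  qed
  have inQ: "y \<in> ?Q" if "y \<in> A" "A \<in> ?U" for y A
    using that eq by (auto simp: ultralimit_def dest: in_quotient_imp_subset)
  have nem: "\<exists>y. y \<in> A" if "A \<in> ?U" for A
    using in_quotient_imp_non_empty[OF eq, of A] that unfolding ultralimit_def by blast
  have rel: "((\<lambda>n. d n (y n) (z n)) \<longlongrightarrow> 0) \<omega>" if "y \<in> A" "z \<in> A" "A \<in> ?U" for y z A
    using quotient_eq_iff[OF eq, of A A y z] that by (simp add: ultralimit_def ultralimit_rel_def)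
  have dist: "((\<lambda>n. d n (y n) (z n)) \<longlongrightarrow> ?D A B) \<omega>"
    if AB: "A \<in> ?U" "B \<in> ?U" "y \<in> A" "z \<in> B" for A B y z
  proof -
    note yz = inQ[OF AB(3,1)] inQ[OF AB(4,2)]
    obtain r where r: "((\<lambda>n. d n (y n) (z n)) \<longlongrightarrow> r) \<omega>" using lim[OF yz] ..
    have "r' = r"
      if y'z': "y' \<in> A" "z' \<in> B" "((\<lambda>n. d n (y' n) (z' n)) \<longlongrightarrow> r') \<omega>" for y' z' r'
    proof -
      note Q' = inQ[OF y'z'(1) AB(1)] inQ[OF y'z'(2) AB(2)]
      obtain t where t: "((\<lambda>n. d n (y n) (z' n)) \<longlongrightarrow> t) \<omega>" using lim[OF yz(1) Q'(2)] ..
      have "t \<le> r + 0" by (rule limtri[OF yz Q'(2) t r rel[OF AB(4) y'z'(2) AB(2)]])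
      moreover have "r \<le> t + 0"
        by (rule limtri[OF yz(1) Q'(2) yz(2) r t rel[OF y'z'(2) AB(4) AB(2)]])
      moreover have "t \<le> 0 + r'"
        by (rule limtri[OF yz(1) Q' t rel[OF AB(3) y'z'(1) AB(1)] y'z'(3)])
      moreover have "r' \<le> 0 + t"
        by (rule limtri[OF Q'(1) yz(1) Q'(2) y'z'(3) rel[OF y'z'(1) AB(3) AB(1)] t])
      ultimately show ?thesis by simp
    qed
    then have "(THE r. \<exists>y\<in>A. \<exists>z\<in>B. ((\<lambda>n. d n (y n) (z n)) \<longlongrightarrow> r) \<omega>) = r"
      using r AB(3,4) by (intro the_equality) blast+
    with AB r show ?thesis by (simp add: ultralimit_dist_def)
  qed
  show "Metric_space ?U ?D"
  proof
    fix A B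
    show "0 \<le> ?D A B"
    proof (cases "A \<in> ?U \<and> B \<in> ?U")
      case True
      then obtain y z where "y \<in> A" "z \<in> B" using nem by meson
      with True show ?thesis by (intro lim0[of y z] inQ[of _ A] inQ[of _ B] dist) auto
    qed (auto simp: ultralimit_dist_def)
    show "?D A B = ?D B A"
    proof (cases "A \<in> ?U \<and> B \<in> ?U")
      case True
      then obtain y z where yz: "y \<in> A" "z \<in> B" using nem by meson
      have "((\<lambda>n. d n (y n) (z n)) \<longlongrightarrow> ?D B A) \<omega>"
        using True yz by (intro limsym[of z y] inQ[of _ A] inQ[of _ B] dist) auto
      with dist[of A B y z] True yz show ?thesis by (intro tendsto_unique[OF ne]) auto
    qed (auto simp: ultralimit_dist_def)
  next
    fix A B assume AB: "A \<in> ?U" "B \<in> ?U"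
    then obtain y z where yz: "y \<in> A" "z \<in> B" using nem by meson
    have "A = B \<longleftrightarrow> (y, z) \<in> ?R"
      using quotient_eq_iff[OF eq, of A B y z] AB yz by (simp add: ultralimit_def)
    also have "\<dots> \<longleftrightarrow> ((\<lambda>n. d n (y n) (z n)) \<longlongrightarrow> 0) \<omega>"
      using inQ AB yz by (auto simp: ultralimit_rel_def)
    also have "\<dots> \<longleftrightarrow> ?D A B = 0"
    proof
      assume "((\<lambda>n. d n (y n) (z n)) \<longlongrightarrow> 0) \<omega>"
      then show "?D A B = 0" by (rule tendsto_unique[OF ne dist[OF AB yz]])
    qed (use dist[OF AB yz] in simp)
    finally show "?D A B = 0 \<longleftrightarrow> A = B" by simp
  next
    fix A B C assume ABC: "A \<in> ?U" "B \<in> ?U" "C \<in> ?U"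
    then obtain y z w where "y \<in> A" "z \<in> B" "w \<in> C" using nem by meson
    with ABC show "?D A C \<le> ?D A B + ?D B C"
      by (intro limtri[of y z w] inQ[of _ A] inQ[of _ B] inQ[of _ C] dist) auto
  qed
  have "x \<in> ?Q"
    using x by (auto simp: ultralimit_seqs_def d0 intro!: exI[of _ 0])
  then show "?U \<noteq> {}" unfolding ultralimit_def by (auto simp: quotient_def)
qed

definition asymptotic_cone ::
  "nat filter \<Rightarrow> ('a, 'm) monoid_scheme \<Rightarrow> 'a set \<Rightarrow> (nat \<Rightarrow> 'a) \<Rightarrow> (nat \<Rightarrow> real) \<Rightarrow>
     (nat \<Rightarrow> 'a) set topology" where
  "asymptotic_cone \<omega> G S x s =
     (let M = (\<lambda>n. carrier G); d = (\<lambda>n g h. word_dist G S g h / s n)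
      in Metric_space.mtopology (ultralimit \<omega> M d x) (ultralimit_dist \<omega> M d x))"

lemma
  assumes "group G" "finite_generating_set G S" "nonprincipal_ultrafilter \<omega>"
    and "\<And>n. x n \<in> carrier G" "\<And>n. s n > 0"
  defines "d \<equiv> \<lambda>n g h. word_dist G S g h / s n"
  shows Metric_space_asymptotic_cone:
      "Metric_space (ultralimit \<omega> (\<lambda>n. carrier G) d x) (ultralimit_dist \<omega> (\<lambda>n. carrier G) d x)"
    and topspace_asymptotic_cone:
      "topspace (asymptotic_cone \<omega> G S x s) = ultralimit \<omega> (\<lambda>n. carrier G) d x"
    and asymptotic_cone_nonempty: "topspace (asymptotic_cone \<omega> G S x s) \<noteq> {}"
proof -
  note p = word_dist_props[OF assms(1,2)]
  have tri: "word_dist G S u w / s n \<le> word_dist G S u v / s n + word_dist G S v w / s n"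
    if "u \<in> carrier G" "v \<in> carrier G" "w \<in> carrier G" for n u v w
    using divide_right_mono[OF p(3)[OF that] less_imp_le[OF assms(5)[of n]]]
    by (simp add: add_divide_distrib)
  have nn: "0 \<le> word_dist G S u v / s n" for u v n
    using assms(5)[of n] by (simp add: word_dist_def)
  have sym: "word_dist G S u v / s n = word_dist G S v u / s n"
    if "u \<in> carrier G" "v \<in> carrier G" for n u v
    by (simp only: p(2)[OF that])
  note M = Metric_space_ultralimit[OF assms(3), of x "\<lambda>n. carrier G" d]
  show 1: "Metric_space (ultralimit \<omega> (\<lambda>n. carrier G) d x) (ultralimit_dist \<omega> (\<lambda>n. carrier G) d x)"
    by (rule M(1)) (unfold d_def, (rule assms(4) nn tri sym | simp add: p(1))+)
  show 2: "topspace (asymptotic_cone \<omega> G S x s) = ultralimit \<omega> (\<lambda>n. carrier G) d x"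
    using Metric_space.topspace_mtopology[OF 1] by (simp add: asymptotic_cone_def d_def Let_def)
  have "ultralimit \<omega> (\<lambda>n. carrier G) d x \<noteq> {}"
    by (rule M(2)) (unfold d_def, (rule assms(4) nn tri sym | simp add: p(1))+)
  with 2 show "topspace (asymptotic_cone \<omega> G S x s) \<noteq> {}" by simp
qed

text \<open>The library's \<^const>\<open>simply_connected\<close> is only about subsets of topological spaces given by a
  type class. Loops are contracted relative to their base point.\<close>

definition simply_connected_space :: "'a topology \<Rightarrow> bool" where
  "simply_connected_space X \<longleftrightarrow>
     path_connected_space X \<and>
     (\<forall>p. pathin X p \<and> p 0 = p 1 \<longrightarrow>
        homotopic_with (\<lambda>q. q 0 = p 0 \<and> q 1 = p 0) (top_of_set {0..1}) X p (\<lambda>t. p 0))"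

end

theory Submission
  imports Defs
begin

text \<open>Let a word act on level \<open>k\<close> of the tree with an infinite dihedral quotient of the free product of
  \<open>\<langle>a\<rangle>\<close> and \<open>\<langle>b, c, d\<rangle>\<close> attached to every vertex. Taking sections halves lengths, so every relator
  of the Grigorchuk group of length at most \<open>2 ^ k\<close> acts trivially, and the words acting trivially
  form a normal subgroup. Lysenok's relator \<open>\<sigma>\<^sup>k((ad)\<^sup>4)\<close>, of length \<open>8 \<cdot> 2 ^ k\<close>, acts nontrivially.
  Hence the relation range meets every interval \<open>(2 ^ k, 8 \<cdot> 2 ^ k]\<close>.

  In an asymptotic cone with scaling sequence \<open>s\<close>, the relators with \<open>2 ^ k \<approx> s n\<close> define a Lipschitz
  loop. A null-homotopy, sampled on a fine grid and lifted to the group, would write the relator as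
  a product of conjugates of grid squares, which are relators of length at most \<open>2 ^ k\<close>.\<close>

section \<open>Words in the four generators and their sections\<close>

datatype gen = GA | GB | GC | GD

fun gen_fun :: "gen \<Rightarrow> bool list \<Rightarrow> bool list" where
  "gen_fun GA = grig_a"
| "gen_fun GB = grig_b"
| "gen_fun GC = grig_c"
| "gen_fun GD = grig_d"

abbreviation tree_act :: "gen list \<Rightarrow> bool list \<Rightarrow> bool list" where
  "tree_act \<equiv> foldr gen_fun"

text \<open>The second component is a copy of the integers at every vertex, on which the section at that
  vertex acts through the infinite dihedral quotient \<open>a \<mapsto> (x \<mapsto> -x)\<close>, \<open>b \<mapsto> id\<close>,
  \<open>c, d \<mapsto> (x \<mapsto> 1 - x)\<close> of the free product of \<open>\<langle>a\<rangle>\<close> and the four-group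
  \<open>\<langle>b, c, d\<rangle>\<close>.\<close>

fun gen_act :: "gen \<Rightarrow> bool list \<times> int \<Rightarrow> bool list \<times> int" where
  "gen_act GA ([], x) = ([], - x)"
| "gen_act GB ([], x) = ([], x)"
| "gen_act GC ([], x) = ([], 1 - x)"
| "gen_act GD ([], x) = ([], 1 - x)"
| "gen_act GA (y # v, x) = ((\<not> y) # v, x)"
| "gen_act GB (False # v, x) = apfst ((#) False) (gen_act GA (v, x))"
| "gen_act GB (True # v, x) = apfst ((#) True) (gen_act GC (v, x))"
| "gen_act GC (False # v, x) = apfst ((#) False) (gen_act GA (v, x))"
| "gen_act GC (True # v, x) = apfst ((#) True) (gen_act GD (v, x))"
| "gen_act GD (False # v, x) = (False # v, x)"
| "gen_act GD (True # v, x) = apfst ((#) True) (gen_act GB (v, x))"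

abbreviation word_act :: "gen list \<Rightarrow> bool list \<times> int \<Rightarrow> bool list \<times> int" where
  "word_act \<equiv> foldr gen_act"

text \<open>Sections are kept as words rather than as tree automorphisms, because the action on the
  integers at deeper vertices depends on the word and not only on the automorphism that it
  represents.\<close>

fun gen_section :: "gen \<Rightarrow> bool \<Rightarrow> gen list" where
  "gen_section GA y = []"
| "gen_section GB y = (if y then [GC] else [GA])"
| "gen_section GC y = (if y then [GD] else [GA])"
| "gen_section GD y = (if y then [GB] else [])"

fun root_act :: "gen list \<Rightarrow> bool \<Rightarrow> bool" where
  "root_act [] y = y"
| "root_act (g # w) y = (root_act w y \<noteq> (g = GA))"

text \<open>Words act from right to left, so the letter \<open>g\<close> meets the vertex only after
  \<open>w\<close> has moved it.\<close>

fun word_section :: "gen list \<Rightarrow> bool \<Rightarrow> gen list" where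
  "word_section [] y = []"
| "word_section (g # w) y = gen_section g (root_act w y) @ word_section w y"

lemma gen_act_Cons:
  "gen_act g (y # v, x) = apfst ((#) (y \<noteq> (g = GA))) (word_act (gen_section g y) (v, x))"
  by (cases g; cases y) auto

lemma gen_fun_Cons: "gen_fun g (y # v) = (y \<noteq> (g = GA)) # tree_act (gen_section g y) v"
  by (cases g; cases y) auto

lemma word_act_Cons:
  "word_act w (y # v, x) = apfst ((#) (root_act w y)) (word_act (word_section w y) (v, x))"
proof (induction w)
  case (Cons g w)
  obtain v' x' where "word_act (word_section w y) (v, x) = (v', x')" by fastforce
  with Cons show ?case by (simp add: gen_act_Cons)
qed simp

lemma tree_act_Cons: "tree_act w (y # v) = root_act w y # tree_act (word_section w y) v"
  by (induction w) (auto simp: gen_fun_Cons)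

lemma gen_fun_Nil [simp]: "gen_fun g [] = []"
  by (cases g) auto

lemma tree_act_Nil [simp]: "tree_act w [] = []"
  by (induction w) auto

lemma fst_gen_act: "fst (gen_act g p) = gen_fun g (fst p)"
  by (induction g p rule: gen_act.induct) auto

lemma fst_word_act: "fst (word_act w p) = tree_act w (fst p)"
  by (induction w) (auto simp: fst_gen_act)

lemma length_gen_fun: "length (gen_fun g v) = length v"
proof (induction v arbitrary: g)
  case (Cons y v)
  then show ?case
    using Cons[of GA] Cons[of GB] Cons[of GC] Cons[of GD]
    by (cases g; cases y) (auto simp: gen_fun_Cons)
qed simp

lemma length_tree_act: "length (tree_act w v) = length v"
  by (induction w) (auto simp: length_gen_fun)

lemma word_act_level: "length (fst (word_act w p)) = length (fst p)"
  by (simp add: fst_word_act length_tree_act)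

lemma gen_act_involution [simp]: "gen_act g (gen_act g p) = p"
proof -
  have "gen_act g (gen_act g (v, x)) = (v, x)" for v x
  proof (induction v arbitrary: g)
    case Nil show ?case by (cases g) auto
  next
    case (Cons y v)
    have "gen_act h (gen_act h (v, x)) = (v, x)" for h by (rule Cons)
    then show ?case
      by (cases g; cases y) (auto simp: gen_act_Cons apfst_def map_prod_def split_beta)
  qed
  then show ?thesis by (cases p) simp
qed

lemma gen_fun_involution [simp]: "gen_fun g (gen_fun g v) = v"
  using fst_gen_act[of g "gen_act g (v, 0)"] by (simp add: fst_gen_act)

lemma word_act_rev [simp]: "word_act (rev w) (word_act w p) = p"
  by (induction w) auto

lemma word_act_rev' [simp]: "word_act w (word_act (rev w) p) = p"
  using word_act_rev[of "rev w" p] by simp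

lemma tree_act_rev [simp]: "tree_act (rev w) (tree_act w v) = v"
  by (induction w) auto

lemma tree_act_rev' [simp]: "tree_act w (tree_act (rev w) v) = v"
  using tree_act_rev[of "rev w" v] by simp

lemma root_act_append: "root_act (u @ w) y = root_act u (root_act w y)"
  by (induction u) auto

lemma word_section_append:
  "word_section (u @ w) y = word_section u (root_act w y) @ word_section w y"
  by (induction u) (auto simp: root_act_append)

section \<open>Contraction\<close>

text \<open>The product of two distinct elements of \<open>{b, c, d}\<close> is the third one.\<close>

fun third :: "gen \<Rightarrow> gen \<Rightarrow> gen" where
  "third GB GC = GD" | "third GC GB = GD"
| "third GB GD = GC" | "third GD GB = GC"
| "third GC GD = GB" | "third GD GC = GB"
| "third g h = GA"

lemma third_neq: "g \<noteq> GA \<Longrightarrow> h \<noteq> GA \<Longrightarrow> g \<noteq> h \<Longrightarrow> third g h \<noteq> GA"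
  by (cases g; cases h) auto

lemma gen_act_third:
  assumes "g \<noteq> GA" "h \<noteq> GA" "g \<noteq> h"
  shows "gen_act g (gen_act h p) = gen_act (third g h) p"
proof -
  \<comment> \<open>At the root b is the identity and c, d are the same reflection. Below
    \<open>True\<close> the three identities are permuted cyclically, so they are proved together;
    the opposite orders follow because the generators are involutions.\<close>
  have 1: "gen_act GB (gen_act GC (v, x)) = gen_act GD (v, x) \<and>
        gen_act GC (gen_act GD (v, x)) = gen_act GB (v, x) \<and>
        gen_act GD (gen_act GB (v, x)) = gen_act GC (v, x)" for v x
  proof (induction v)
    case (Cons y v)
    then show ?case by (cases y) (auto simp: gen_act_Cons apfst_def map_prod_def split_beta)
  qed simp
  have 2: "gen_act GB (gen_act GC q) = gen_act GD q" "gen_act GC (gen_act GD q) = gen_act GB q"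
     "gen_act GD (gen_act GB q) = gen_act GC q" for q
    using 1[of "fst q" "snd q"] by auto
  have 3: "gen_act GC (gen_act GB q) = gen_act GD q" "gen_act GD (gen_act GC q) = gen_act GB q"
     "gen_act GB (gen_act GD q) = gen_act GC q" for q
    by (metis 2 gen_act_involution)+
  show ?thesis using assms 2 3 by (cases g; cases h) auto
qed

text \<open>These are the normal forms of the free product of the group generated by a and the
  four-group of b, c, d.\<close>

fun alternating :: "gen list \<Rightarrow> bool" where
  "alternating (g # h # w) \<longleftrightarrow> (g = GA \<longleftrightarrow> h \<noteq> GA) \<and> alternating (h # w)"
| "alternating _ \<longleftrightarrow> True"

lemma alternating_tl: "alternating (g # w) \<Longrightarrow> alternating w"
  by (cases w) auto

text \<open>Cancelling equal neighbours and merging two distinct letters among b, c, d never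
  lengthens a word, and it preserves the action on the integers as well as the one on the
  tree.\<close>

lemma ex_alternating:
  "\<exists>w'. alternating w' \<and> length w' \<le> length w \<and> word_act w' = word_act w"
proof (induction w)
  case Nil
  show ?case by (intro exI[of _ "[]"]) auto
next
  case (Cons g w)
  then obtain u where u: "alternating u" "length u \<le> length w" "word_act u = word_act w" by blast
  consider "u = []" | h t where "u = h # t" "g = h"
    | h t where "u = h # t" "g \<noteq> h" "g \<noteq> GA" "h \<noteq> GA"
    | h t where "u = h # t" "g = GA \<longleftrightarrow> h \<noteq> GA"
    by (cases u) auto
  then show ?case
  proof cases
    case 1 with u show ?thesis by (intro exI[of _ "[g]"]) (auto simp: fun_eq_iff)
  next
    case 2 with u show ?thesis
      by (intro exI[of _ t]) (auto simp: fun_eq_iff alternating_tl simp flip: u(3))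
  next
    case 3
    then have "alternating (third g h # t)"
      using u(1) third_neq[of g h] by (cases t) auto
    with 3 u show ?thesis
      by (intro exI[of _ "third g h # t"]) (auto simp: fun_eq_iff gen_act_third simp flip: u(3))
  next
    case 4 with u show ?thesis by (intro exI[of _ "g # u"]) (auto simp: fun_eq_iff)
  qed
qed

text \<open>\<open>GA\<close> contributes nothing to a section and any other letter contributes at
  most one letter. In an alternating word these other letters make up half of the length, up to
  rounding when the first letter is one of them.\<close>

lemma length_section_alternating:
  assumes "alternating w"
  shows "2 * length (word_section w y) \<le> length w + (if w \<noteq> [] \<and> hd w \<noteq> GA then 1 else 0)"
  using assms
proof (induction w rule: alternating.induct)
  case (1 g h w)
  have "length (gen_section g z) \<le> (if g = GA then 0 else 1)" for z by (cases g) auto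
  from this[of "root_act (h # w) y"] 1 show ?case by (auto split: if_splits)
next
  case ("2_2" g)
  show ?case by (cases g) auto
qed simp

lemma gen_fun_neq_id: "gen_fun g \<noteq> id"
proof -
  \<comment> \<open>The generator d fixes every vertex of depth at most 2, so detecting it takes a
    vertex of depth 3.\<close>
  have "gen_fun g [True, False, False] \<noteq> [True, False, False] \<or> gen_fun g [False, False] \<noteq> [False, False]"
    by (cases g) auto
  then show ?thesis by auto
qed

text \<open>A relator fixes the first level and its sections are relators again. Once the word is
  alternating, each passage to a section halves the bound on the length; after \<open>k\<close> of
  them it is 1, and no single generator is trivial.\<close>

lemma short_relator_level:
  assumes "tree_act w = id" "length w \<le> 2 ^ k" "length v = k"
  shows "word_act w (v, x) = (v, x)"
  using assms
proof (induction k arbitrary: w v)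
  case 0
  then have "w = [] \<or> (\<exists>g. w = [g])" by (cases w) auto
  moreover have "w \<noteq> [g]" for g
    using 0(1) gen_fun_neq_id[of g] by (auto simp: id_def)
  ultimately show ?case by auto
next
  case (Suc k)
  obtain u where u: "alternating u" "length u \<le> length w" "word_act u = word_act w"
    using ex_alternating by blast
  have tu: "tree_act u z = z" for z
    using fst_word_act[of u "(z, 0)"] fst_word_act[of w "(z, 0)"] Suc.prems(1) u(3) by simp
  obtain y t where v: "v = y # t" "length t = k" using Suc.prems(3) by (cases v) auto
  have r: "root_act u y = y" and s: "tree_act (word_section u y) z = z" for z
    using tu[of "y # z"] by (auto simp: tree_act_Cons)
  \<comment> \<open>The surplus 1 is lost in halving because lengths are integers, so the bound
    \<open>2 ^ k\<close> is reached exactly.\<close>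
  have "2 * length (word_section u y) \<le> 2 ^ Suc k + 1"
    using length_section_alternating[OF u(1), of y] u(2) Suc.prems(2) by (auto split: if_splits)
  then have "length (word_section u y) \<le> 2 ^ k" by simp
  moreover have "tree_act (word_section u y) = id" using s by auto
  ultimately have "word_act (word_section u y) (t, x) = (t, x)"
    using Suc.IH v(2) by blast
  with r show ?case unfolding u(3)[symmetric] v(1) by (simp add: word_act_Cons)
qed

text \<open>This congruence on words plays the part of equality modulo a normal subgroup containing
  all relators of length at most \<open>2 ^ k\<close>. Products of conjugates then need not be
  written out.\<close>

definition level_eq :: "nat \<Rightarrow> gen list \<Rightarrow> gen list \<Rightarrow> bool" where
  "level_eq k u w \<longleftrightarrow> (\<forall>p. length (fst p) = k \<longrightarrow> word_act u p = word_act w p)"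

lemma level_eq_append:
  "level_eq k u u' \<Longrightarrow> level_eq k w w' \<Longrightarrow> level_eq k (u @ w) (u' @ w')"
  unfolding level_eq_def by (metis foldr_append comp_apply word_act_level)

lemma level_eq_refl [simp]: "level_eq k u u"
  by (simp add: level_eq_def)

lemma level_eq_trans [trans]: "level_eq k u w \<Longrightarrow> level_eq k w t \<Longrightarrow> level_eq k u t"
  by (simp add: level_eq_def)

text \<open>Reversal inverts a word of involutions, so \<open>rev w @ u\<close> is a relator to
  which the length bound applies.\<close>

lemma short_relation_level:
  assumes "tree_act u = tree_act w" "length u + length w \<le> 2 ^ k"
  shows "level_eq k u w"
  unfolding level_eq_def
proof (intro allI impI)
  fix p :: "bool list \<times> int" assume p: "length (fst p) = k"
  have "tree_act (rev w @ u) = id"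
    using assms(1) by (auto simp: fun_eq_iff)
  from short_relator_level[OF this _ p, of "snd p"] assms(2)
  have "word_act (rev w) (word_act u p) = p" by simp
  then show "word_act u p = word_act w p" by (metis word_act_rev')
qed

section \<open>Long relators\<close>

text \<open>Lysenok's substitution, chosen so that the section of \<open>\<sigma>(w)\<close> at \<open>True\<close> is \<open>w\<close>.\<close>

fun lysenok :: "gen \<Rightarrow> gen list" where
  "lysenok GA = [GA, GC, GA]"
| "lysenok GB = [GD]"
| "lysenok GC = [GB]"
| "lysenok GD = [GC]"

fun lysenok_iter :: "nat \<Rightarrow> gen list \<Rightarrow> gen list" where
  "lysenok_iter 0 w = w"
| "lysenok_iter (Suc k) w = concat (map lysenok (lysenok_iter k w))"

definition relator :: "nat \<Rightarrow> gen list" where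
  "relator k = concat (replicate 4 (lysenok_iter k [GA, GD]))"

lemma relator_Suc: "relator (Suc k) = concat (map lysenok (relator k))"
  by (simp add: relator_def numeral_eq_Suc)

text \<open>Each substituted letter contains \<open>GA\<close> either twice or not at all.\<close>

lemma root_act_lysenok [simp]: "root_act (concat (map lysenok w)) y = y"
proof (induction w)
  case (Cons g w)
  then show ?case by (cases g) (auto simp: root_act_append)
qed simp

lemma word_section_lysenok_True: "word_section (concat (map lysenok w)) True = w"
proof (induction w)
  case (Cons g w)
  then show ?case by (cases g) (auto simp: word_section_append)
qed simp

text \<open>Substituting and then taking the section at \<open>False\<close> sends a to d, b to the
  empty word, and both c and d to a.\<close>

lemma set_word_section_lysenok_False:
  "set (word_section (concat (map lysenok w)) False) \<subseteq> {GA, GD}"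
proof (induction w)
  case (Cons g w)
  then show ?case by (cases g) (auto simp: word_section_append)
qed simp

text \<open>The sections of a word in \<open>a, d\<close> are powers of \<open>b\<close>, and its square fixes the first level.\<close>

lemma fourth_power_trivial:
  assumes "set w \<subseteq> {GA, GD}"
  shows "tree_act (concat (replicate 4 w)) = id"
proof
  fix v :: "bool list"
  have b: "set (word_section w y) \<subseteq> {GB}" for y
    using assms by (induction w) auto
  \<comment> \<open>Every letter flips or keeps the first coordinate, so \<open>root_act w\<close>
    is the identity or the flip.\<close>
  have rt: "root_act w (root_act w y) = y" for y
  proof -
    have "root_act w (\<not> y) = (\<not> root_act w y)" for y by (induction w) auto
    from this[of True] show ?thesis
      by (cases y; cases "root_act w True") auto
  qed
  \<comment> \<open>A power of b is a palindrome, hence its own inverse.\<close>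
  have sq: "tree_act u (tree_act u z) = z" if "set u \<subseteq> {GB}" for u z
  proof -
    have "u = replicate (length u) GB" using that by (intro replicate_eqI) auto
    then have "rev u = u" by (metis rev_replicate)
    then show ?thesis by (metis tree_act_rev)
  qed
  show "tree_act (concat (replicate 4 w)) v = id v"
  proof (cases v)
    case (Cons y t)
    define u where "u = word_section w (root_act w y) @ word_section w y"
    have "tree_act (w @ w) (y # s) = y # tree_act u s" for s
      unfolding tree_act_Cons u_def by (simp add: word_section_append root_act_append rt)
    moreover have "tree_act u (tree_act u t) = t"
      using b by (intro sq) (auto simp: u_def)
    moreover have "concat (replicate 4 w) = (w @ w) @ (w @ w)" by (simp add: numeral_eq_Suc)
    then have "tree_act (concat (replicate 4 w)) v = tree_act (w @ w) (tree_act (w @ w) v)"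
      by (simp only: foldr_append comp_apply)
    ultimately show ?thesis
      unfolding Cons id_apply by (simp only:)
  qed simp
qed

lemma word_section_concat_replicate:
  assumes "\<And>y. root_act w y = y"
  shows "word_section (concat (replicate n w)) y = concat (replicate n (word_section w y))"
proof -
  have "root_act (concat (replicate n w)) y = y" for n by (induction n) (auto simp: assms root_act_append)
  then show ?thesis by (induction n) (auto simp: word_section_append)
qed

text \<open>The section of \<open>relator (Suc k)\<close> at \<open>True\<close> is
  \<open>relator k\<close>, and the one at \<open>False\<close> is the fourth power of a word in a
  and d.\<close>

lemma tree_act_relator: "tree_act (relator k) = id"
proof (induction k)
  case 0
  show ?case using fourth_power_trivial[of "[GA, GD]"] by (simp add: relator_def)
next
  case (Suc k)
  show ?case
  proof
    fix v :: "bool list"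
    show "tree_act (relator (Suc k)) v = id v"
    proof (cases v)
      case (Cons y t)
      have r: "root_act (relator (Suc k)) y = y" by (simp add: relator_Suc)
      have "tree_act (word_section (relator (Suc k)) y) = id"
      proof (cases y)
        case True
        then have "word_section (relator (Suc k)) y = relator k"
          by (simp add: relator_Suc word_section_lysenok_True)
        then show ?thesis by (metis Suc)
      next
        case False
        have "word_section (relator (Suc k)) False =
            concat (replicate 4 (word_section (lysenok_iter (Suc k) [GA, GD]) False))"
          unfolding relator_def by (rule word_section_concat_replicate) simp
        also have "tree_act \<dots> = id"
          by (intro fourth_power_trivial) (simp add: set_word_section_lysenok_False)
        finally show ?thesis using False by (simp only:)
      qed
      with r Cons show ?thesis by (simp add: tree_act_Cons)
    qed simp
  qed
qed

lemma length_relator: "length (relator k) = 8 * 2 ^ k"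
proof -
  let ?a = "\<lambda>w. length (filter (\<lambda>g. g = GA) w)"
  \<comment> \<open>The count of \<open>GA\<close> is carried along because only these letters are
    lengthened; it remains half of the length of the relator, so that the length doubles.\<close>
  have "?a (concat (map lysenok w)) = 2 * ?a w \<and>
      length (concat (map lysenok w)) = length w + 2 * ?a w" for w
  proof (induction w)
    case (Cons g w)
    then show ?case by (cases g) auto
  qed simp
  then have "?a (relator k) = 4 * 2 ^ k \<and> length (relator k) = 8 * 2 ^ k"
    by (induction k) (auto simp: relator_Suc, auto simp: relator_def numeral_eq_Suc)
  then show ?thesis ..
qed

text \<open>Along the vertices \<open>True\<close> the sections lead back to the fourth power of ad,
  and ad acts on the integers as the translation by -1.\<close>

lemma relator_level: "\<not> level_eq k (relator k) []"
proof -
  have "word_act (relator k) (replicate k True, x) = (replicate k True, x - 4)" for x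
  proof (induction k)
    case 0
    show ?case by (simp add: relator_def numeral_eq_Suc)
  next
    case (Suc k)
    then show ?case by (simp add: word_act_Cons relator_Suc word_section_lysenok_True)
  qed
  then show ?thesis unfolding level_eq_def
    by (auto intro!: exI[of _ "replicate k True"] exI[of _ "0::int"])
qed

section \<open>The Grigorchuk group is densely related\<close>

lemma range_gen_fun: "range gen_fun = {grig_a, grig_b, grig_c, grig_d}"
proof -
  have UNIV_gen: "UNIV = {GA, GB, GC, GD}" using gen.exhaust by blast
  show ?thesis unfolding UNIV_gen by simp
qed

text \<open>Distinctness of the generators lets a letter of the free group be read back as a
  generator.\<close>

lemma inj_gen_fun: "inj gen_fun"
proof (rule injI)
  fix g h assume "gen_fun g = gen_fun h"
  then have "gen_fun g v = gen_fun h v" for v by simp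
  from this[of "[False, False]"] this[of "[True, False, False]"] show "g = h"
    by (cases g; cases h) auto
qed

lemma inv_gen_fun [simp]: "inv_into UNIV gen_fun (gen_fun g) = g"
  by (rule inv_f_f[OF inj_gen_fun])

lemma tree_aut_simps [simp]: "(\<otimes>\<^bsub>tree_aut\<^esub>) = (\<circ>)" "\<one>\<^bsub>tree_aut\<^esub> = id"
  by (simp_all add: tree_aut_def)

lemma grigorchuk_simps [simp]: "(\<otimes>\<^bsub>grigorchuk_group\<^esub>) = (\<circ>)" "\<one>\<^bsub>grigorchuk_group\<^esub> = id"
  by (simp_all add: grigorchuk_group_def tree_aut_def)

section \<open>The group as the set of products of four involutions\<close>

lemma gen_fun_in_tree_aut: "gen_fun g \<in> carrier tree_aut"
  using grig_in_tree_aut range_gen_fun by blast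

lemma inv_tree_aut_gen_fun: "inv\<^bsub>tree_aut\<^esub> (gen_fun g) = gen_fun g"
  by (rule group.inv_equality[OF group_tree_aut]) (auto simp: gen_fun_in_tree_aut fun_eq_iff)

lemma carrier_grigorchuk: "carrier grigorchuk_group = range tree_act"
proof -
  have "f \<in> range tree_act" if "f \<in> generate tree_aut (range gen_fun)" for f
    using that
  proof (induction rule: generate.induct)
    case one
    show ?case by (rule range_eqI[of _ _ "[]"]) auto
  next
    case (incl f)
    then obtain g where "f = gen_fun g" by blast
    then show ?case by (intro range_eqI[of _ _ "[g]"]) auto
  next
    case (inv f)
    then obtain g where "f = gen_fun g" by blast
    then show ?case by (intro range_eqI[of _ _ "[g]"]) (auto simp: inv_tree_aut_gen_fun)
  next
    case (eng f h)
    then obtain u w where "f = tree_act u" "h = tree_act w" by blast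
    then show ?case by (intro range_eqI[of _ _ "u @ w"]) (auto simp: foldr_append)
  qed
  moreover have "tree_act w \<in> generate tree_aut (range gen_fun)" for w
  proof (induction w)
    case Nil show ?case using generate.one[of tree_aut] by (simp flip: id_def)
  next
    case (Cons g w)
    have "gen_fun g \<otimes>\<^bsub>tree_aut\<^esub> tree_act w \<in> generate tree_aut (range gen_fun)"
      by (intro generate.eng generate.incl Cons) simp
    then show ?case by (simp add: comp_def)
  qed
  ultimately show ?thesis
    by (auto simp: grigorchuk_group_def range_gen_fun)
qed

lemma tree_act_in_grigorchuk [simp]: "tree_act w \<in> carrier grigorchuk_group"
  by (simp add: carrier_grigorchuk)

lemma gen_fun_in_grigorchuk [simp]: "gen_fun g \<in> carrier grigorchuk_group"
  using tree_act_in_grigorchuk[of "[g]"] by (simp del: tree_act_in_grigorchuk)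

lemma inv_grigorchuk_tree_act: "inv\<^bsub>grigorchuk_group\<^esub> (tree_act w) = tree_act (rev w)"
  by (rule group.inv_equality[OF group_grigorchuk_group]) (auto simp: fun_eq_iff)

lemma inv_grigorchuk_gen_fun: "inv\<^bsub>grigorchuk_group\<^esub> (gen_fun g) = gen_fun g"
  using inv_grigorchuk_tree_act[of "[g]"] by simp

text \<open>The group is generated inside all tree automorphisms, while a generating set has to
  generate inside the group itself; the two closures agree.\<close>

lemma generate_grigorchuk: "generate grigorchuk_group (range gen_fun) = carrier grigorchuk_group"
proof -
  have "range gen_fun \<subseteq> generate tree_aut (range gen_fun)" by (rule subsetI) (rule generate.incl)
  moreover have "subgroup (generate tree_aut (range gen_fun)) tree_aut"
    by (intro group.generate_is_subgroup group_tree_aut) (simp add: image_subset_iff gen_fun_in_tree_aut)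
  ultimately have "generate (tree_aut\<lparr>carrier := generate tree_aut (range gen_fun)\<rparr>) (range gen_fun) =
      generate tree_aut (range gen_fun)"
    by (rule group.generate_consistent[OF group_tree_aut])
  then show ?thesis
    unfolding grigorchuk_group_def range_gen_fun by simp
qed

lemma finite_generating_set_grigorchuk: "finite_generating_set grigorchuk_group (range gen_fun)"
proof -
  have "finite (range gen_fun)" by (simp add: range_gen_fun)
  moreover have "range gen_fun \<subseteq> carrier grigorchuk_group" by (simp add: image_subset_iff)
  ultimately show ?thesis using generate_grigorchuk by (simp add: finite_generating_set_def)
qed

section \<open>Free group elements as words in the generators\<close>

definition letters_to_word :: "(bool list \<Rightarrow> bool list) letter list \<Rightarrow> gen list" where
  "letters_to_word = map (inv_into UNIV gen_fun \<circ> fst)"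

text \<open>Only positive letters are used, so every word becomes reduced as it stands, even one
  with equal neighbours. In the other direction exponents are forgotten, which is harmless for
  involutions.\<close>

definition word_to_letters :: "gen list \<Rightarrow> (bool list \<Rightarrow> bool list) letter list" where
  "word_to_letters = map (\<lambda>g. (gen_fun g, True))"

lemma letters_to_word_to_letters [simp]: "letters_to_word (word_to_letters w) = w"
  by (induction w) (auto simp: letters_to_word_def word_to_letters_def)

lemma length_word_to_letters [simp]: "length (word_to_letters w) = length w"
  by (simp add: word_to_letters_def)

lemma length_letters_to_word [simp]: "length (letters_to_word w) = length w"
  by (simp add: letters_to_word_def)

lemma word_to_letters_in_free_group: "word_to_letters w \<in> carrier (free_group (range gen_fun))"
proof -
  have "reduced_word (map (\<lambda>g. (gen_fun g, True)) w)"
    by (induction w rule: induct_list012) (auto simp: inv_letter_def)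
  then show ?thesis by (auto simp: free_group_def word_to_letters_def)
qed

lemma eval_word_grigorchuk:
  assumes "w \<in> carrier (free_group (range gen_fun))"
  shows "eval_word grigorchuk_group w = tree_act (letters_to_word w)"
proof -
  have "fst ` set w \<subseteq> range gen_fun" using assms by (simp add: free_group_def)
  then show ?thesis
  proof (induction w)
    case (Cons x w)
    then obtain g where "fst x = gen_fun g" by auto
    with Cons show ?case
      by (auto simp: eval_word_def letters_to_word_def eval_letter_def inv_grigorchuk_gen_fun)
  qed (auto simp: eval_word_def letters_to_word_def)
qed

text \<open>This kernel of the action on level \<open>k\<close> separates the relators of length at
  most \<open>2 ^ k\<close>, which it contains, from \<open>relator k\<close>, which it does
  not.\<close>

definition level_kernel :: "nat \<Rightarrow> (bool list \<Rightarrow> bool list) letter list set" where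
  "level_kernel k = {w \<in> carrier (free_group (range gen_fun)). level_eq k (letters_to_word w) []}"

text \<open>A letter and its formal inverse become the same involution, so free reduction does not
  alter the action.\<close>

lemma word_act_free_mult:
  "word_act (letters_to_word (foldr red_cons u w)) p =
     word_act (letters_to_word u) (word_act (letters_to_word w) p)"
proof (induction u)
  case (Cons x u)
  have "word_act (letters_to_word (red_cons x t)) p = word_act (letters_to_word (x # t)) p" for t
    by (cases t) (auto simp: letters_to_word_def)
  with Cons show ?case by (simp add: letters_to_word_def)
qed (simp add: letters_to_word_def)

lemma level_kernel_normal: "level_kernel k \<lhd> free_group (range gen_fun)"
proof -
  let ?F = "free_group (range gen_fun)"
  interpret group ?F by (rule group_free_group)
  have act: "word_act (letters_to_word (u \<otimes>\<^bsub>?F\<^esub> w)) p =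
      word_act (letters_to_word u) (word_act (letters_to_word w) p)" for u w p
    using word_act_free_mult by (simp add: free_group_def)
  have one: "word_act (letters_to_word \<one>\<^bsub>?F\<^esub>) p = p" for p
    by (simp add: free_group_def letters_to_word_def)
  have act_inv: "word_act (letters_to_word u) (word_act (letters_to_word (inv\<^bsub>?F\<^esub> u)) p) = p"
      "word_act (letters_to_word (inv\<^bsub>?F\<^esub> u)) (word_act (letters_to_word u) p) = p"
    if "u \<in> carrier ?F" for u p
    using that by (simp_all add: one flip: act)
  show ?thesis
    unfolding normal_inv_iff
  proof (intro conjI subgroupI ballI)
    show "level_kernel k \<noteq> {}"
      using one_closed by (auto simp: level_kernel_def level_eq_def one)
    show "inv\<^bsub>?F\<^esub> u \<in> level_kernel k" if "u \<in> level_kernel k" for u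
    proof -
      have "word_act (letters_to_word (inv\<^bsub>?F\<^esub> u)) p = p" if "length (fst p) = k" for p
      proof -
        have "word_act (letters_to_word u) p = p" "u \<in> carrier ?F"
          using that \<open>u \<in> level_kernel k\<close> by (cases p; simp add: level_kernel_def level_eq_def)+
        with act_inv(2)[of u p] show ?thesis by simp
      qed
      with that show ?thesis by (simp add: level_kernel_def level_eq_def)
    qed
    show "u \<otimes>\<^bsub>?F\<^esub> w \<in> level_kernel k" if "u \<in> level_kernel k" "w \<in> level_kernel k" for u w
      using that by (auto simp: level_kernel_def level_eq_def act)
    show "u \<otimes>\<^bsub>?F\<^esub> w \<otimes>\<^bsub>?F\<^esub> inv\<^bsub>?F\<^esub> u \<in> level_kernel k"
      if "u \<in> carrier ?F" "w \<in> level_kernel k" for u w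
    proof -
      \<comment> \<open>Levels are preserved, so \<open>w\<close> also fixes the image of a point
        under the inverse of \<open>u\<close>, and \<open>u\<close> carries that image back.\<close>
      have "word_act (letters_to_word w) q = q" if "length (fst q) = k" for q
        using that \<open>w \<in> level_kernel k\<close> by (cases q) (simp add: level_kernel_def level_eq_def)
      with that show ?thesis
        unfolding level_kernel_def level_eq_def by (simp add: act word_act_level act_inv)
    qed
  qed (auto simp: level_kernel_def)
qed

lemma relators_upto_level:
  assumes "n \<le> 2 ^ k"
  shows "relators_upto grigorchuk_group (range gen_fun) n \<subseteq> level_kernel k"
proof -
  have "w \<in> level_kernel k"
    if "w \<in> carrier (free_group (range gen_fun))" "eval_word grigorchuk_group w = id"
      "int (length w) \<le> n" for w
  proof -
    have "int (length w) \<le> int (2 ^ k)" by (rule order_trans[OF that(3)]) (use assms in simp)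
    then have "length w \<le> 2 ^ k" by (simp only: of_nat_le_iff)
    moreover have "tree_act (letters_to_word w) = tree_act []"
      using that(2) by (auto simp: eval_word_grigorchuk[OF that(1)])
    ultimately have "level_eq k (letters_to_word w) []"
      by (intro short_relation_level) auto
    with that(1) show ?thesis by (simp add: level_kernel_def)
  qed
  then have "{w \<in> kernel (free_group (range gen_fun)) grigorchuk_group (eval_word grigorchuk_group).
      int (length w) \<le> n} \<subseteq> level_kernel k"
    by (auto simp: kernel_def)
  then show ?thesis
    unfolding relators_upto_def normal_closure_def using level_kernel_normal by blast
qed

lemma relator_in_relators_upto:
  "word_to_letters (relator k) \<in> relators_upto grigorchuk_group (range gen_fun) (8 * 2 ^ k)"
  by (auto simp: relators_upto_def normal_closure_def kernel_def word_to_letters_in_free_group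
      eval_word_grigorchuk tree_act_relator length_relator)

lemma relators_upto_mono: "m \<le> n \<Longrightarrow> relators_upto G S m \<subseteq> relators_upto G S n"
  unfolding relators_upto_def normal_closure_def by fastforce

text \<open>When the subgroup for \<open>n\<close> lies inside the one for \<open>m\<close> but the
  next subgroup does not, the latter is strictly larger and \<open>n + 1\<close> is in the range.
  The bound on \<open>m\<close> keeps this number nonnegative.\<close>

lemma ex_relation_range:
  assumes "-1 \<le> m" "m \<le> n" "\<not> relators_upto G S n \<subseteq> relators_upto G S m"
  shows "\<exists>r\<in>relation_range G S. m < r \<and> r \<le> n"
  using assms(2,3)
proof (induction n rule: int_ge_induct)
  case (step n)
  show ?case
  proof (cases "relators_upto G S n \<subseteq> relators_upto G S m")
    case True
    then have "n + 1 \<in> relation_range G S"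
      using step assms(1) relators_upto_mono[of n "n + 1" G S]
      by (auto simp: relation_range_def)
    with step show ?thesis by force
  qed (use step in force)
qed simp

lemma densely_related_grigorchuk: "densely_related grigorchuk_group"
  unfolding densely_related_def
proof (intro exI[of _ "range gen_fun"] exI[of _ "16::real"] conjI allI impI)
  fix n :: int assume n: "n \<ge> 1"
  \<comment> \<open>The least such \<open>k\<close> gives a power of 2 below \<open>2 * n\<close>.
    With the relator length \<open>8 * 2 ^ k\<close> this yields the constant 16.\<close>
  obtain k where k: "n \<le> 2 ^ k" "2 ^ k < 2 * n"
  proof -
    have "int (nat n) \<le> int (2 ^ nat n)"
      unfolding of_nat_le_iff by (rule less_imp_le[OF less_exp])
    then have ex: "\<exists>k. n \<le> 2 ^ k" using n by auto
    define k where "k = (LEAST k. n \<le> 2 ^ k)"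
    have "n \<le> 2 ^ k" unfolding k_def using ex by (rule LeastI_ex)
    moreover have "2 ^ k < 2 * n"
    proof (cases k)
      case (Suc j)
      then have "\<not> n \<le> 2 ^ j" unfolding k_def by (intro not_less_Least) simp
      with Suc show ?thesis by simp
    qed (use n in simp)
    ultimately show ?thesis ..
  qed
  have "\<not> relators_upto grigorchuk_group (range gen_fun) (8 * 2 ^ k)
      \<subseteq> relators_upto grigorchuk_group (range gen_fun) (n - 1)"
    using relator_in_relators_upto[of k] relators_upto_level[of "n - 1" k] k(1) relator_level[of k]
    by (auto simp: level_kernel_def)
  then obtain r where "r \<in> relation_range grigorchuk_group (range gen_fun)" "n - 1 < r" "r \<le> 8 * 2 ^ k"
    using ex_relation_range[of "n - 1" "8 * 2 ^ k"] n k by force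
  with k show "\<exists>m\<in>relation_range grigorchuk_group (range gen_fun). n \<le> m \<and> real_of_int m \<le> 16 * real_of_int n"
    by (intro bexI[of _ r]) auto
qed (use finite_generating_set_grigorchuk in auto)

section \<open>Null-homotopic loops in ultralimits\<close>

locale ultralimit_space =
  fixes \<omega> :: "nat filter" and M :: "nat \<Rightarrow> 'a set" and d :: "nat \<Rightarrow> 'a \<Rightarrow> 'a \<Rightarrow> real"
    and x :: "nat \<Rightarrow> 'a"
  assumes \<omega>: "nonprincipal_ultrafilter \<omega>"
    and base: "\<And>n. x n \<in> M n"
    and d_nonneg: "\<And>n u v. u \<in> M n \<Longrightarrow> v \<in> M n \<Longrightarrow> 0 \<le> d n u v"
    and d_refl: "\<And>n u. u \<in> M n \<Longrightarrow> d n u u = 0"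
    and d_commute: "\<And>n u v. u \<in> M n \<Longrightarrow> v \<in> M n \<Longrightarrow> d n u v = d n v u"
    and d_triangle: "\<And>n u v w. u \<in> M n \<Longrightarrow> v \<in> M n \<Longrightarrow> w \<in> M n \<Longrightarrow> d n u w \<le> d n u v + d n v w"
begin

abbreviation "Q \<equiv> ultralimit_seqs \<omega> M d x"
abbreviation "R \<equiv> ultralimit_rel \<omega> M d x"
abbreviation "U \<equiv> ultralimit \<omega> M d x"
abbreviation "D \<equiv> ultralimit_dist \<omega> M d x"

sublocale Metric_space U D
  by (rule Metric_space_ultralimit) (fact \<omega> base d_nonneg d_refl d_commute d_triangle)+

section \<open>Representatives of points and their limit distances\<close>

lemma nontrivial: "\<omega> \<noteq> bot"
  using \<omega> by (simp add: nonprincipal_ultrafilter_def)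

lemma seqs_mem: "y \<in> Q \<Longrightarrow> y n \<in> M n"
  by (simp add: ultralimit_seqs_def)

lemma seqs_limit:
  assumes y: "y \<in> Q" and z: "z \<in> Q"
  shows "\<exists>r. ((\<lambda>n. d n (y n) (z n)) \<longlongrightarrow> r) \<omega>"
proof -
  obtain C C' where "eventually (\<lambda>n. d n (x n) (y n) \<le> C) \<omega>" "eventually (\<lambda>n. d n (x n) (z n) \<le> C') \<omega>"
    using y z by (auto simp: ultralimit_seqs_def)
  then have "eventually (\<lambda>n. d n (y n) (z n) \<in> {0..C + C'}) \<omega>"
  proof eventually_elim
    case (elim n)
    have m: "x n \<in> M n" "y n \<in> M n" "z n \<in> M n" using seqs_mem y z base by auto
    then show ?case
      using d_triangle[of "y n" n "x n" "z n"] d_commute[of "y n" n "x n"] d_nonneg[of "y n" n "z n"] elim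
      by simp
  qed
  with \<omega> show ?thesis by (rule ultrafilter_bounded_tendsto)
qed

lemma equiv_rel: "equiv Q R"
proof (rule equivI)
  show "R \<subseteq> Q \<times> Q" by (auto simp: ultralimit_rel_def)
  show "refl_on Q R"
    unfolding refl_on_def ultralimit_rel_def by (simp add: d_refl seqs_mem)
  show "sym R"
  proof (rule symI)
    fix y z assume "(y, z) \<in> R"
    moreover from this have "d n (z n) (y n) = d n (y n) (z n)" for n
      by (intro d_commute seqs_mem) (auto simp: ultralimit_rel_def)
    ultimately show "(z, y) \<in> R" by (simp add: ultralimit_rel_def)
  qed
  show "trans R"
  proof (rule transI)
    fix y z w assume yz: "(y, z) \<in> R" and zw: "(z, w) \<in> R"
    have m: "y n \<in> M n" "z n \<in> M n" "w n \<in> M n" for n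
      using yz zw by (auto simp: ultralimit_rel_def intro!: seqs_mem)
    have "((\<lambda>n. d n (y n) (z n) + d n (z n) (w n)) \<longlongrightarrow> 0) \<omega>"
      using yz zw by (intro tendsto_add_zero) (auto simp: ultralimit_rel_def)
    from _ _ tendsto_const this have "((\<lambda>n. d n (y n) (w n)) \<longlongrightarrow> 0) \<omega>"
      by (rule tendsto_sandwich) (intro always_eventually allI d_nonneg d_triangle m)+
    with yz zw show "(y, w) \<in> R" by (auto simp: ultralimit_rel_def)
  qed
qed

lemma point_subset: "A \<in> U \<Longrightarrow> A \<subseteq> Q"
  unfolding ultralimit_def by (rule in_quotient_imp_subset[OF equiv_rel])

lemma ex_representative: "A \<in> U \<Longrightarrow> \<exists>y. y \<in> A"
  using in_quotient_imp_non_empty[OF equiv_rel] by (auto simp: ultralimit_def)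

lemma point_rel:
  assumes "A \<in> U" "y \<in> A" "z \<in> A"
  shows "((\<lambda>n. d n (y n) (z n)) \<longlongrightarrow> 0) \<omega>"
  using in_quotient_imp_in_rel[OF equiv_rel, of A y z] assms
  by (auto simp: ultralimit_def ultralimit_rel_def)

lemma dist_limit:
  assumes A: "A \<in> U" "y \<in> A" and B: "B \<in> U" "z \<in> B"
  shows "((\<lambda>n. d n (y n) (z n)) \<longlongrightarrow> D A B) \<omega>"
proof -
  \<comment> \<open>Replacing representatives changes the distances by errors tending to 0. The
    inequality is used in both directions, which makes the limit in the definite description
    unique.\<close>
  have lim_le: "r \<le> r'"
    if "y \<in> A" "y' \<in> A" "z \<in> B" "z' \<in> B" "((\<lambda>n. d n (y n) (z n)) \<longlongrightarrow> r) \<omega>"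
      "((\<lambda>n. d n (y' n) (z' n)) \<longlongrightarrow> r') \<omega>" for y y' z z' r r'
  proof -
    have m: "y n \<in> M n" "y' n \<in> M n" "z n \<in> M n" "z' n \<in> M n" for n
      using that point_subset A(1) B(1) by (auto intro!: seqs_mem)
    have "((\<lambda>n. d n (y n) (y' n) + d n (y' n) (z' n) + d n (z' n) (z n)) \<longlongrightarrow> 0 + r' + 0) \<omega>"
      using that A B by (intro tendsto_add point_rel)
    moreover have "d n (y n) (z n) \<le> d n (y n) (y' n) + d n (y' n) (z' n) + d n (z' n) (z n)" for n
      using d_triangle[of "y n" n "y' n" "z n"] d_triangle[of "y' n" n "z' n" "z n"] m by simp
    ultimately have "r \<le> 0 + r' + 0"
      using that(5) by (intro tendsto_le[OF nontrivial]) auto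
    then show ?thesis by (simp add: Ball_def)
  qed
  obtain r where r: "((\<lambda>n. d n (y n) (z n)) \<longlongrightarrow> r) \<omega>"
    using seqs_limit point_subset A B by blast
  have "(THE r. \<exists>y\<in>A. \<exists>z\<in>B. ((\<lambda>n. d n (y n) (z n)) \<longlongrightarrow> r) \<omega>) = r"
    using r A(2) B(2) lim_le by (intro the_equality) (blast, metis order_antisym)
  with A(1) B(1) r show ?thesis by (simp add: ultralimit_dist_def)
qed

definition point :: "(nat \<Rightarrow> 'a) \<Rightarrow> (nat \<Rightarrow> 'a) set" where
  "point y = R `` {y}"

lemma point_in: "y \<in> Q \<Longrightarrow> point y \<in> U"
  by (simp add: point_def ultralimit_def quotientI)

lemma in_point: "y \<in> Q \<Longrightarrow> y \<in> point y"
  unfolding point_def by (rule equiv_class_self[OF equiv_rel])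

lemma base_in_seqs: "x \<in> Q"
  by (auto simp: ultralimit_seqs_def base d_refl intro!: exI[of _ 0])

section \<open>From null-homotopies to finite grids\<close>

lemma homotopy_uniformly_continuous:
  fixes h :: "real \<times> real \<Rightarrow> (nat \<Rightarrow> 'a) set"
  assumes "continuous_map (prod_topology (top_of_set {0..1}) (top_of_set {0..1})) mtopology h" "e > 0"
  shows "\<exists>\<delta>>0. \<forall>p\<in>{0..1} \<times> {0..1}. \<forall>q\<in>{0..1} \<times> {0..1}. dist q p < \<delta> \<longrightarrow> D (h q) (h p) < e"
proof -
  let ?S = "{0..1::real} \<times> {0..1::real}"
  have "compact ?S" by (intro compact_Times compact_Icc)
  then have "uniformly_continuous_map (submetric euclidean_metric ?S) (metric (U, D)) h"
    using assms(1)
    by (intro continuous_imp_uniformly_continuous_map)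
      (simp add: mtopology_of_submetric compact_space_subtopology)
  with assms(2) show ?thesis
    by (simp add: uniformly_continuous_map_def)
qed

text \<open>A null-homotopy is uniformly continuous, so neighbouring samples on a fine grid are
  close. The side \<open>j = 0\<close> is the given loop and the other three are constant as
  sequences, not only up to equivalence, so that exact words can be attached to the
  boundary.\<close>

lemma null_homotopic_loop_grid:
  fixes \<gamma> :: "real \<Rightarrow> nat \<Rightarrow> 'a"
  assumes sc: "simply_connected_space mtopology"
    and mem: "\<And>t n. \<gamma> t n \<in> M n" and ends: "\<gamma> 0 = x" "\<gamma> 1 = x"
    and err: "(err \<longlongrightarrow> 0) \<omega>"
    and lip: "eventually (\<lambda>n. \<forall>s t. 0 \<le> s \<longrightarrow> s \<le> t \<longrightarrow> t \<le> 1 \<longrightarrow>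
      d n (\<gamma> s n) (\<gamma> t n) \<le> L * (t - s) + err n) \<omega>"
    and e: "e > 0"
  shows "\<exists>K\<ge>N. \<exists>y. (\<forall>i j n. y i j n \<in> M n) \<and> (\<forall>i\<le>K. y i 0 = \<gamma> (real i / real K)) \<and>
    (\<forall>i. y i K = x) \<and> (\<forall>j. y 0 j = x \<and> y K j = x) \<and>
    eventually (\<lambda>n. \<forall>i<K. \<forall>j\<le>K. d n (y i j n) (y (Suc i) j n) < e) \<omega> \<and>
    eventually (\<lambda>n. \<forall>i\<le>K. \<forall>j<K. d n (y i j n) (y i (Suc j) n) < e) \<omega>"
proof -
  have \<gamma>_lim: "L * (t - s) \<ge> r"
    if "0 \<le> s" "s \<le> t" "t \<le> 1" "((\<lambda>n. d n (\<gamma> s n) (\<gamma> t n)) \<longlongrightarrow> r) \<omega>" for s t r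
  proof -
    have "((\<lambda>n. L * (t - s) + err n) \<longlongrightarrow> L * (t - s) + 0) \<omega>"
      by (intro tendsto_add tendsto_const err)
    moreover have "eventually (\<lambda>n. d n (\<gamma> s n) (\<gamma> t n) \<le> L * (t - s) + err n) \<omega>"
      using lip by eventually_elim (use that in blast)
    ultimately have "r \<le> L * (t - s) + 0"
      using that(4) by (intro tendsto_le[OF nontrivial])
    then show ?thesis by (simp add: Ball_def)
  qed
  have \<gamma>Q: "\<gamma> t \<in> Q" if "t \<in> {0..1}" for t
  proof -
    have "eventually (\<lambda>n. err n < 1) \<omega>"
      by (rule order_tendstoD(2)[OF err]) simp
    with lip have "eventually (\<lambda>n. d n (x n) (\<gamma> t n) \<le> L * t + 1) \<omega>"
    proof eventually_elim
      case (elim n)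
      have "d n (\<gamma> 0 n) (\<gamma> t n) \<le> L * (t - 0) + err n" using that by (intro elim(1)[rule_format]) auto
      with elim(2) ends(1) show ?case by simp
    qed
    with mem show ?thesis by (auto simp: ultralimit_seqs_def)
  qed
  define p where "p t = point (\<gamma> t)" for t
  have p_in: "p t \<in> U" if "t \<in> {0..1}" for t
    using that by (simp add: p_def point_in \<gamma>Q)
  have p_le: "D (p s) (p t) \<le> L * (t - s)" if "0 \<le> s" "s \<le> t" "t \<le> 1" for s t
    using that by (intro \<gamma>_lim dist_limit p_in) (auto simp: p_def intro!: in_point \<gamma>Q)
  have p_lip: "D (p s) (p t) \<le> \<bar>L\<bar> * \<bar>s - t\<bar>" if "s \<in> {0..1}" "t \<in> {0..1}" for s t
  proof (cases "s \<le> t")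
    case True
    have "L * (t - s) \<le> \<bar>L\<bar> * \<bar>s - t\<bar>" using True by (intro mult_mono) auto
    with p_le[of s t] True that show ?thesis by simp
  next
    case False
    have "L * (s - t) \<le> \<bar>L\<bar> * \<bar>s - t\<bar>" using False by (intro mult_mono) auto
    moreover have "D (p t) (p s) \<le> L * (s - t)" using p_le[of t s] False that by simp
    ultimately show ?thesis using commute[of "p s" "p t"] by linarith
  qed
  have "pathin mtopology p"
    unfolding pathin_def continuous_map_to_metric
  proof (intro ballI allI impI)
    fix t e :: real assume "t \<in> topspace (top_of_set {0..1})" and e: "e > 0"
    then have t: "t \<in> {0..1}" by simp
    \<comment> \<open>\<open>L\<close> may have any sign, hence the absolute value; the summand 1
      keeps the denominator positive.\<close>
    define r where "r = e / (\<bar>L\<bar> + 1)"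
    have r: "r > 0" using e by (simp add: r_def)
    have "p u \<in> mball (p t) e" if u: "u \<in> {0..1} \<inter> ball t r" for u
    proof -
      have "\<bar>L\<bar> * \<bar>t - u\<bar> \<le> \<bar>L\<bar> * r"
        using u by (intro mult_left_mono) (auto simp: dist_real_def)
      also have "\<dots> < e" using e by (simp add: r_def field_simps)
      finally show ?thesis using p_lip[of t u] t u p_in by (auto simp: in_mball)
    qed
    with r t show "\<exists>V. openin (top_of_set {0..1}) V \<and> t \<in> V \<and> (\<forall>u\<in>V. p u \<in> mball (p t) e)"
      by (intro exI[of _ "{0..1} \<inter> ball t r"]) (auto intro: openin_open_Int)
  qed
  moreover have px: "p 0 = point x" "p 1 = point x" by (simp_all add: p_def ends)
  ultimately have "homotopic_with (\<lambda>q. q 0 = p 0 \<and> q 1 = p 0) (top_of_set {0..1}) mtopology p (\<lambda>t. p 0)"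
    using sc[unfolded simply_connected_space_def, THEN conjunct2, THEN spec, of p]
    by (simp only: simp_thms)
  then have "homotopic_with (\<lambda>q. q 0 = point x \<and> q 1 = point x) (top_of_set {0..1}) mtopology p (\<lambda>t. point x)"
    by (simp only: px)
  then obtain h :: "real \<times> real \<Rightarrow> (nat \<Rightarrow> 'a) set" where
    h: "continuous_map (prod_topology (top_of_set {0..1}) (top_of_set {0..1})) mtopology h"
    and h0: "\<And>t. h (0, t) = p t" and h1: "\<And>t. h (1, t) = point x"
    and hx: "\<And>t. t \<in> {0..1} \<Longrightarrow> h (t, 0) = point x \<and> h (t, 1) = point x"
    unfolding homotopic_with_def by blast
  obtain \<delta> where \<delta>: "\<delta> > 0"
    "\<And>p q. p \<in> {0..1} \<times> {0..1} \<Longrightarrow> q \<in> {0..1} \<times> {0..1} \<Longrightarrow> dist q p < \<delta> \<Longrightarrow> D (h q) (h p) < e"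
    using homotopy_uniformly_continuous[OF h e] by blast
  obtain K0 :: nat where K0: "1 / \<delta> < K0" using reals_Archimedean2 by blast
  \<comment> \<open>Besides a mesh below \<delta>, the grid needs the requested size
    \<open>N\<close> and at least one cell.\<close>
  define K where "K = max (max K0 N) 1"
  have K: "K \<ge> N" "K \<ge> 1" "1 / real K < \<delta>"
  proof -
    show "K \<ge> N" "K \<ge> 1" by (auto simp: K_def)
    have "1 / \<delta> < real K" using K0 by (simp add: K_def)
    then show "1 / real K < \<delta>" using \<delta>(1) \<open>K \<ge> 1\<close> by (simp add: field_simps)
  qed
  \<comment> \<open>The homotopy takes its time first; here \<open>i\<close> runs along the loop and
    \<open>j\<close> along the time.\<close>
  define P where "P i j = h (real j / real K, real i / real K)" for i j :: nat
  have sq: "(real j / real K, real i / real K) \<in> {0..1} \<times> {0..1}" if "i \<le> K" "j \<le> K" for i j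
    using that K(2) by auto
  have P_in: "P i j \<in> U" if "i \<le> K" "j \<le> K" for i j
    using continuous_map_funspace[OF h] sq[OF that] by (auto simp: P_def)
  have step: "\<bar>real (Suc i) / real K - real i / real K\<bar> = 1 / real K" for i
    by (simp add: divide_simps)
  have P_dist: "D (P i j) (P (Suc i) j) < e" if "i < K" "j \<le> K" for i j
    unfolding P_def using that K(3)
    by (intro \<delta>(2) sq) (auto simp: dist_prod_def dist_real_def step abs_minus_commute[of "real i / real K"] simp del: of_nat_Suc)
  have P_dist': "D (P i j) (P i (Suc j)) < e" if "i \<le> K" "j < K" for i j
    unfolding P_def using that K(3)
    by (intro \<delta>(2) sq) (auto simp: dist_prod_def dist_real_def step abs_minus_commute[of "real j / real K"] simp del: of_nat_Suc)
  \<comment> \<open>Boundary representatives are prescribed and only interior ones are chosen.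
    Indices beyond the grid get the base sequence, so that membership holds for all of them.\<close>
  define y where "y i j = (if K \<le> i \<or> K \<le> j \<or> i = 0 then x
      else if j = 0 then \<gamma> (real i / real K) else (SOME z. z \<in> P i j))" for i j
  have y_in: "y i j \<in> P i j" if "i \<le> K" "j \<le> K" for i j
  proof -
    have "x \<in> P i j" if "i = K \<or> j = K \<or> i = 0"
      using that \<open>i \<le> K\<close> \<open>j \<le> K\<close> K(2) hx[of "real j / real K"] h1 in_point[OF base_in_seqs]
      by (auto simp: P_def)
    moreover have "\<gamma> (real i / real K) \<in> P i 0"
      using \<open>i \<le> K\<close> K(2) in_point \<gamma>Q by (simp add: P_def h0 p_def)
    moreover have "(SOME z. z \<in> P i j) \<in> P i j"
      using ex_representative[OF P_in[OF that]] by (rule someI_ex)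
    ultimately show ?thesis using that by (auto simp: y_def)
  qed
  have near: "eventually (\<lambda>n. d n (y i j n) (y i' j' n) < e) \<omega>"
    if "i \<le> K" "j \<le> K" "i' \<le> K" "j' \<le> K" "D (P i j) (P i' j') < e" for i j i' j'
    by (rule order_tendstoD(2)[OF dist_limit[OF P_in[OF that(1,2)] y_in[OF that(1,2)] P_in[OF that(3,4)] y_in[OF that(3,4)]] that(5)])
  have "y i j n \<in> M n" for i j n
  proof (cases "i \<le> K \<and> j \<le> K")
    case True
    then show ?thesis using y_in P_in point_subset seqs_mem by blast
  qed (auto simp: y_def base)
  moreover have "\<forall>i\<le>K. y i 0 = \<gamma> (real i / real K)"
    using K(2) by (auto simp: y_def ends)
  moreover have "eventually (\<lambda>n. \<forall>i<K. \<forall>j\<le>K. d n (y i j n) (y (Suc i) j n) < e) \<omega>"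
  proof -
    have "eventually (\<lambda>n. \<forall>i\<in>{..<K}. \<forall>j\<in>{..K}. d n (y i j n) (y (Suc i) j n) < e) \<omega>"
    proof (intro eventually_ball_finite ballI finite_atMost finite_lessThan)
      fix i j assume "i \<in> {..<K}" "j \<in> {..K}"
      then show "eventually (\<lambda>n. d n (y i j n) (y (Suc i) j n) < e) \<omega>"
        using near[of i j "Suc i" j] P_dist[of i j] by auto
    qed
    then show ?thesis by (simp add: Ball_def)
  qed
  moreover have "eventually (\<lambda>n. \<forall>i\<le>K. \<forall>j<K. d n (y i j n) (y i (Suc j) n) < e) \<omega>"
  proof -
    have "eventually (\<lambda>n. \<forall>i\<in>{..K}. \<forall>j\<in>{..<K}. d n (y i j n) (y i (Suc j) n) < e) \<omega>"
    proof (intro eventually_ball_finite ballI finite_atMost finite_lessThan)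
      fix i j assume "i \<in> {..K}" "j \<in> {..<K}"
      then show "eventually (\<lambda>n. d n (y i j n) (y i (Suc j) n) < e) \<omega>"
        using near[of i j i "Suc j"] P_dist'[of i j] by auto
    qed
    then show ?thesis by (simp add: Ball_def)
  qed
  ultimately show ?thesis
    using K(1) by (intro exI[of _ K] exI[of _ y] conjI) (auto simp: y_def)
qed

end

section \<open>Asymptotic cones of the Grigorchuk group\<close>

text \<open>Read \<open>H i j\<close> and \<open>V i j\<close> as labels of the edges from the
  vertex \<open>(i, j)\<close> to its right and upper neighbours. The bottom side is pushed across
  one row at a time until it becomes the trivial top side.\<close>

lemma level_eq_grid:
  fixes H V :: "nat \<Rightarrow> nat \<Rightarrow> gen list"
  assumes square: "\<And>i j. i < K \<Longrightarrow> j < K \<Longrightarrow> level_eq k (H i j @ V (Suc i) j) (V i j @ H i (Suc j))"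
    and sides: "\<And>j. j < K \<Longrightarrow> V 0 j = [] \<and> V K j = []" and top: "\<And>i. i < K \<Longrightarrow> H i K = []"
  shows "level_eq k (concat (map (\<lambda>i. H i 0) [0..<K])) []"
proof -
  let ?row = "\<lambda>j m. concat (map (\<lambda>i. H i j) [0..<m])"
  \<comment> \<open>Within a row, the vertical edge moves from the right end to the left end, one
    square at a time.\<close>
  have row: "level_eq k (?row j m @ V m j) (V 0 j @ ?row (Suc j) m)" if "j < K" "m \<le> K" for j m
    using \<open>m \<le> K\<close>
  proof (induction m)
    case (Suc m)
    then have "level_eq k (?row j m @ H m j @ V (Suc m) j) (?row j m @ V m j @ H m (Suc j))"
      using square[of m j] that by (intro level_eq_append[OF level_eq_refl]) auto
    moreover have "level_eq k ((?row j m @ V m j) @ H m (Suc j)) ((V 0 j @ ?row (Suc j) m) @ H m (Suc j))"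
      using Suc by (intro level_eq_append[OF _ level_eq_refl]) auto
    ultimately show ?case by (auto dest: level_eq_trans)
  qed simp
  have "level_eq k (?row 0 K) (?row j K)" if "j \<le> K" for j
    using that
  proof (induction j)
    case (Suc j)
    then show ?case using row[of j K] sides[of j] by (auto intro: level_eq_trans)
  qed simp
  moreover have "?row K K = []" using top by simp
  ultimately show ?thesis by (metis order_refl)
qed

lemma concat_segments:
  fixes q :: "nat \<Rightarrow> nat"
  assumes "q 0 = 0" "mono q"
  shows "concat (map (\<lambda>i. take (q (Suc i) - q i) (drop (q i) u)) [0..<m]) = take (q m) u"
proof (induction m)
  case (Suc m)
  have "q (Suc m) = q m + (q (Suc m) - q m)" using monoD[OF assms(2), of m "Suc m"] by simp
  then have "take (q (Suc m)) u = take (q m) u @ take (q (Suc m) - q m) (drop (q m) u)"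
    by (metis take_add)
  with Suc show ?case by simp
qed (use assms in simp)

section \<open>Comparison of word metrics\<close>

lemma grigorchuk_mult_tree_act:
  "g \<in> carrier grigorchuk_group \<Longrightarrow> g \<circ> tree_act w \<in> carrier grigorchuk_group"
  using group_grigorchuk_group tree_act_in_grigorchuk[of w]
  by (metis grigorchuk_simps(1) group.is_monoid monoid.m_closed)

lemma inv_comp_grigorchuk:
  "g \<in> carrier grigorchuk_group \<Longrightarrow> inv\<^bsub>grigorchuk_group\<^esub> g \<circ> (g \<circ> h) = h"
  by (auto simp: carrier_grigorchuk inv_grigorchuk_tree_act fun_eq_iff)

lemma comp_inv_grigorchuk:
  "g \<in> carrier grigorchuk_group \<Longrightarrow> g \<circ> (inv\<^bsub>grigorchuk_group\<^esub> g \<circ> h) = h"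
  by (auto simp: carrier_grigorchuk inv_grigorchuk_tree_act fun_eq_iff)

text \<open>Reading the word letter by letter gives steps of bounded size, by left invariance of the
  word metric.\<close>

lemma word_dist_le_length:
  assumes "finite_generating_set grigorchuk_group S"
  shows "\<exists>C>0. \<forall>g\<in>carrier grigorchuk_group. \<forall>w.
    word_dist grigorchuk_group S g (g \<circ> tree_act w) \<le> C * real (length w)"
proof -
  let ?d = "word_dist grigorchuk_group S"
  note d = word_dist_props[OF group_grigorchuk_group assms]
  define C where "C = 1 + (\<Sum>g\<in>{GA, GB, GC, GD}. \<bar>?d id (gen_fun g)\<bar>)"
  have C: "C > 0" by (simp add: C_def)
  have gen: "?d id (gen_fun g) \<le> C" for g
    unfolding C_def by (cases g) auto
  have left: "?d g (g \<circ> h) = ?d id h" if "g \<in> carrier grigorchuk_group" for g h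
    using inv_comp_grigorchuk[OF that, of h] inv_comp_grigorchuk[of id h] tree_act_in_grigorchuk[of "[]"]
    by (simp add: word_dist_def flip: id_def)
  have "?d g (g \<circ> tree_act w) \<le> C * real (length w)" if "g \<in> carrier grigorchuk_group" for g w
    using that
  proof (induction w arbitrary: g)
    case Nil
    then show ?case using d(1)[of g] by (simp add: comp_def)
  next
    case (Cons a w)
    have ga: "g \<circ> gen_fun a \<in> carrier grigorchuk_group"
      using grigorchuk_mult_tree_act[OF Cons.prems, of "[a]"] by simp
    have "?d g (g \<circ> tree_act (a # w)) \<le> ?d g (g \<circ> gen_fun a) + ?d (g \<circ> gen_fun a) (g \<circ> tree_act (a # w))"
      by (intro d(3) grigorchuk_mult_tree_act ga Cons.prems)
    moreover have "?d (g \<circ> gen_fun a) (g \<circ> tree_act (a # w)) \<le> C * real (length w)"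
      using Cons.IH[OF ga] by (simp only: foldr_Cons comp_assoc)
    moreover have "?d g (g \<circ> gen_fun a) \<le> C"
      using gen left[OF Cons.prems] by simp
    ultimately have "?d g (g \<circ> tree_act (a # w)) \<le> C + C * real (length w)" by linarith
    also have "\<dots> = C * real (length (a # w))" by (simp add: distrib_left)
    finally show ?case .
  qed
  with C show ?thesis by blast
qed

text \<open>Each letter over \<open>S\<close> is replaced by a fixed word in the four generators,
  reversed for an inverse letter, and the constant bounds the lengths of these words.\<close>

lemma length_le_word_dist:
  assumes S: "finite_generating_set grigorchuk_group S"
  shows "\<exists>C>0. \<forall>g\<in>carrier grigorchuk_group. \<forall>h\<in>carrier grigorchuk_group.
    \<exists>w. h = g \<circ> tree_act w \<and> real (length w) \<le> C * word_dist grigorchuk_group S g h"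
proof -
  have S': "finite S" "S \<subseteq> carrier grigorchuk_group" "generate grigorchuk_group S = carrier grigorchuk_group"
    using S by (auto simp: finite_generating_set_def)
  have "\<forall>s\<in>S. \<exists>w. tree_act w = s" using S'(2) by (auto simp: carrier_grigorchuk)
  then obtain W where W: "\<And>s. s \<in> S \<Longrightarrow> tree_act (W s) = s" by metis
  define C where "C = 1 + (\<Sum>s\<in>S. length (W s))"
  have WC: "length (W s) \<le> C" if "s \<in> S" for s
    using member_le_sum[OF that, of "\<lambda>s. length (W s)"] S'(1) by (simp add: C_def)
  have ex: "\<exists>w. tree_act w = eval_word grigorchuk_group u \<and> length w \<le> C * length u"
    if "fst ` set u \<subseteq> S" for u
    using that
  proof (induction u)
    case Nil
    show ?case by (intro exI[of _ "[]"]) (auto simp: eval_word_def)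
  next
    case (Cons p u)
    then obtain w where w: "tree_act w = eval_word grigorchuk_group u" "length w \<le> C * length u" by auto
    obtain s b where p: "p = (s, b)" "s \<in> S" using Cons.prems by (cases p) auto
    define v where "v = (if b then W s else rev (W s))"
    have "tree_act v = eval_letter grigorchuk_group p"
      using W[OF p(2)] inv_grigorchuk_tree_act[of "W s"] by (simp add: v_def eval_letter_def p(1))
    moreover have "eval_word grigorchuk_group (p # u) = eval_letter grigorchuk_group p \<circ> eval_word grigorchuk_group u"
      by (simp add: eval_word_def)
    moreover have "length v \<le> C" using WC[OF p(2)] by (simp add: v_def)
    ultimately show ?case using w by (intro exI[of _ "v @ w"]) auto
  qed
  have "\<exists>w. h = g \<circ> tree_act w \<and> real (length w) \<le> real C * word_dist grigorchuk_group S g h"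
    if gh: "g \<in> carrier grigorchuk_group" "h \<in> carrier grigorchuk_group" for g h
  proof -
    let ?k = "inv\<^bsub>grigorchuk_group\<^esub> g \<circ> h"
    have "?k \<in> carrier grigorchuk_group"
      using group.inv_closed[OF group_grigorchuk_group gh(1)] grigorchuk_mult_tree_act gh(2)
      by (auto simp: carrier_grigorchuk)
    then have "\<exists>n. \<exists>u\<in>carrier (free_group S). eval_word grigorchuk_group u = ?k \<and> length u = n"
      using eval_word_surj[OF group_grigorchuk_group S'(2,3)] by (metis imageE)
    from LeastI_ex[OF this] obtain u where u: "u \<in> carrier (free_group S)"
        "eval_word grigorchuk_group u = ?k" "length u = word_length grigorchuk_group S ?k"
      unfolding word_length_def by blast
    then obtain w where "tree_act w = ?k" "length w \<le> C * word_length grigorchuk_group S ?k"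
      using ex[of u] by (auto simp: free_group_def)
    moreover from this(2) have "real (length w) \<le> real (C * word_length grigorchuk_group S ?k)"
      by (simp only: of_nat_le_iff)
    ultimately show ?thesis
      using comp_inv_grigorchuk[OF gh(1), of h] by (intro exI[of _ w]) (simp add: word_dist_def)
  qed
  moreover have "real C > 0" unfolding of_nat_0_less_iff by (simp add: C_def)
  ultimately show ?thesis by blast
qed

lemma not_simply_connected_asymptotic_cone:
  fixes \<omega> :: "nat filter" and x :: "nat \<Rightarrow> bool list \<Rightarrow> bool list" and s :: "nat \<Rightarrow> real"
  assumes \<omega>: "nonprincipal_ultrafilter \<omega>" and S: "finite_generating_set grigorchuk_group S"
    and x: "\<And>n. x n \<in> carrier grigorchuk_group"
    and s_pos: "\<And>n. s n > 0" and s_top: "filterlim s at_top \<omega>"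
  shows "\<not> simply_connected_space (asymptotic_cone \<omega> grigorchuk_group S x s)"
proof
  assume sc: "simply_connected_space (asymptotic_cone \<omega> grigorchuk_group S x s)"
  let ?G = "carrier grigorchuk_group" and ?dS = "word_dist grigorchuk_group S"
  note dS = word_dist_props[OF group_grigorchuk_group S]
  define d where "d = (\<lambda>n g h. ?dS g h / s n)"
  interpret ultralimit_space \<omega> "\<lambda>n. ?G" d x
  proof
    fix n and u v w assume "u \<in> ?G" "v \<in> ?G" "w \<in> ?G"
    then show "d n u w \<le> d n u v + d n v w"
      using dS(3) s_pos[of n] by (simp add: d_def divide_right_mono flip: add_divide_distrib)
  next
    fix n and u v assume uv: "u \<in> ?G" "v \<in> ?G"
    show "0 \<le> d n u v" using s_pos[of n] by (simp add: d_def word_dist_def)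
    show "d n u v = d n v u" by (simp only: d_def dS(2)[OF uv])
  next
    fix n and u assume "u \<in> ?G"
    then show "d n u u = 0" by (simp only: d_def dS(1) div_0)
  qed (use \<omega> x in auto)
  have sc': "simply_connected_space mtopology"
    using sc by (simp add: asymptotic_cone_def d_def Let_def)
  obtain C1 where C1: "C1 > 0" "\<And>g w. g \<in> ?G \<Longrightarrow> ?dS g (g \<circ> tree_act w) \<le> C1 * real (length w)"
    using word_dist_le_length[OF S] by blast
  obtain C2 where C2: "C2 > 0"
      "\<And>g h. g \<in> ?G \<Longrightarrow> h \<in> ?G \<Longrightarrow> \<exists>w. h = g \<circ> tree_act w \<and> real (length w) \<le> C2 * ?dS g h"
    using length_le_word_dist[OF S] by blast
  \<comment> \<open>The exponent is the integer part of the binary logarithm of \<open>s n\<close>.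
    It is constrained only where \<open>s n \<ge> 1\<close>, which holds almost everywhere for the
    ultrafilter.\<close>
  have "\<exists>k. s n \<ge> 1 \<longrightarrow> 2 ^ k \<le> s n \<and> s n < 2 * 2 ^ k" for n
  proof (cases "s n \<ge> 1")
    case True
    then have "1 \<le> nat \<lfloor>s n\<rfloor>" by linarith
    then obtain k where k: "2 ^ k \<le> nat \<lfloor>s n\<rfloor>" "nat \<lfloor>s n\<rfloor> < 2 ^ (k + 1)"
      using ex_power_ivl1[of 2 "nat \<lfloor>s n\<rfloor>"] by auto
    have "real (2 ^ k) \<le> real (nat \<lfloor>s n\<rfloor>)" using k(1) by (simp only: of_nat_le_iff)
    moreover have "real (nat \<lfloor>s n\<rfloor>) \<le> s n" "s n < real (nat \<lfloor>s n\<rfloor>) + 1" using True by linarith+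
    moreover have "real (nat \<lfloor>s n\<rfloor> + 1) \<le> real (2 ^ (k + 1))" using k(2) unfolding of_nat_le_iff by simp
    moreover have "real (2 ^ k) = 2 ^ k" "real (2 ^ (k + 1)) = 2 * 2 ^ k"
      "real (nat \<lfloor>s n\<rfloor> + 1) = real (nat \<lfloor>s n\<rfloor>) + 1" by simp_all
    ultimately have "2 ^ k \<le> s n \<and> s n < 2 * 2 ^ k" by linarith
    then show ?thesis by blast
  qed simp
  then obtain k where k: "\<And>n. s n \<ge> 1 \<Longrightarrow> 2 ^ k n \<le> s n \<and> s n < 2 * 2 ^ k n" by metis
  define l where "l n = 8 * (2::real) ^ k n" for n
  have l: "real (length (relator (k n))) = l n" for n by (simp add: l_def length_relator)
  have l_pos: "l n > 0" for n by (simp add: l_def)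
  \<comment> \<open>At time \<open>t\<close> the loop has read the fraction \<open>t\<close> of the
    relator, rounded down to whole letters.\<close>
  define seg where "seg t n = take (nat \<lfloor>t * l n\<rfloor>) (relator (k n))" for t n
  define \<gamma> where "\<gamma> t n = x n \<circ> tree_act (seg t n)" for t n
  \<comment> \<open>Rounding costs at most one letter, of rescaled length at most
    \<open>C1 / s n\<close>.\<close>
  define err where "err n = C1 / s n" for n
  have err: "(err \<longlongrightarrow> 0) \<omega>"
    unfolding err_def by (rule real_tendsto_divide_at_top[OF tendsto_const s_top])
  have s_large: "eventually (\<lambda>n. s n \<ge> r) \<omega>" for r
    using s_top by (simp add: filterlim_at_top)
  have idx: "real (nat \<lfloor>t * l n\<rfloor> - nat \<lfloor>u * l n\<rfloor>) \<le> l n * (t - u) + 1" "nat \<lfloor>u * l n\<rfloor> \<le> nat \<lfloor>t * l n\<rfloor>"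
    if "0 \<le> u" "u \<le> t" for t u n
  proof -
    have 1: "0 \<le> u * l n" "u * l n \<le> t * l n"
      using that l_pos[of n] by (auto intro: mult_right_mono)
    then show 2: "nat \<lfloor>u * l n\<rfloor> \<le> nat \<lfloor>t * l n\<rfloor>" by (intro nat_mono floor_mono)
    have "real (nat \<lfloor>t * l n\<rfloor>) \<le> t * l n" "u * l n < real (nat \<lfloor>u * l n\<rfloor>) + 1" using 1 by linarith+
    with 2 show "real (nat \<lfloor>t * l n\<rfloor> - nat \<lfloor>u * l n\<rfloor>) \<le> l n * (t - u) + 1"
      by (simp add: of_nat_diff algebra_simps)
  qed
  define piece where "piece u t n = take (nat \<lfloor>t * l n\<rfloor> - nat \<lfloor>u * l n\<rfloor>) (drop (nat \<lfloor>u * l n\<rfloor>) (relator (k n)))" for u t n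
  have length_piece: "real (length (piece u t n)) \<le> l n * (t - u) + 1" if "0 \<le> u" "u \<le> t" for u t n
  proof -
    have "length (piece u t n) \<le> nat \<lfloor>t * l n\<rfloor> - nat \<lfloor>u * l n\<rfloor>" by (simp add: piece_def)
    then show ?thesis using idx(1)[OF that, of n] by linarith
  qed
  have \<gamma>_piece: "\<gamma> t n = \<gamma> u n \<circ> tree_act (piece u t n)" if "0 \<le> u" "u \<le> t" for u t n
  proof -
    have "seg t n = seg u n @ piece u t n"
      using idx(2)[OF that, of n] by (simp add: seg_def piece_def flip: take_add)
    then show ?thesis by (simp add: \<gamma>_def fun_eq_iff)
  qed
  have \<gamma>_mem: "\<gamma> t n \<in> ?G" for t n
    unfolding \<gamma>_def by (intro grigorchuk_mult_tree_act x)
  have \<gamma>0: "\<gamma> 0 = x" by (auto simp: \<gamma>_def seg_def)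
  have \<gamma>1: "\<gamma> 1 = x"
  proof -
    have "seg 1 n = relator (k n)" for n
      by (simp add: seg_def flip: l)
    then show ?thesis by (auto simp: \<gamma>_def tree_act_relator)
  qed
  \<comment> \<open>The Lipschitz constant is \<open>8 * C1\<close> because the relator has length
    \<open>8 * 2 ^ k n\<close>, which is at most \<open>8 * s n\<close>.\<close>
  have "eventually (\<lambda>n. \<forall>u t. 0 \<le> u \<longrightarrow> u \<le> t \<longrightarrow> t \<le> 1 \<longrightarrow>
      d n (\<gamma> u n) (\<gamma> t n) \<le> (8 * C1) * (t - u) + err n) \<omega>"
    using s_large[of 1]
  proof eventually_elim
    case (elim n)
    show ?case
    proof (intro allI impI)
      fix u t :: real assume ut: "0 \<le> u" "u \<le> t" "t \<le> 1"
      have "?dS (\<gamma> u n) (\<gamma> t n) \<le> C1 * real (length (piece u t n))"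
        using C1(2)[OF \<gamma>_mem] \<gamma>_piece[OF ut(1,2)] by simp
      also have "\<dots> \<le> C1 * (l n * (t - u) + 1)"
        using C1(1) length_piece[OF ut(1,2)] by (intro mult_left_mono) auto
      also have "\<dots> \<le> C1 * (8 * s n * (t - u) + 1)"
        using k[OF elim] ut C1(1) by (intro mult_left_mono add_right_mono mult_right_mono) (auto simp: l_def)
      finally have "d n (\<gamma> u n) (\<gamma> t n) \<le> C1 * (8 * s n * (t - u) + 1) / s n"
        using s_pos[of n] by (simp add: d_def divide_right_mono)
      also have "\<dots> = (8 * C1) * (t - u) + err n"
        using s_pos[of n] by (simp add: err_def field_simps)
      finally show "d n (\<gamma> u n) (\<gamma> t n) \<le> (8 * C1) * (t - u) + err n" .
    qed
  qed
  note lip = this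
  \<comment> \<open>Grid edges shorter than \<open>e\<close> are labelled by words of length at most
    \<open>s n / 8\<close>, less than a quarter of \<open>2 ^ k n\<close>. The four sides of a
    square then stay within the bound for short relators.\<close>
  define e where "e = 1 / (8 * C2)"
  have e: "e > 0" using C2(1) by (simp add: e_def)
  \<comment> \<open>With at least 64 columns, each piece of the relator on the bottom side has
    length at most \<open>2 ^ k n / 8 + 1\<close>.\<close>
  from null_homotopic_loop_grid[OF sc' \<gamma>_mem \<gamma>0 \<gamma>1 err lip e, of 64]
  obtain K y where K: "64 \<le> K" and y: "\<And>i j n. y i j n \<in> ?G"
    and y0: "\<And>i. i \<le> K \<Longrightarrow> y i 0 = \<gamma> (real i / real K)"
    and yK: "\<And>i. y i K = x" and y_sides: "\<And>j. y 0 j = x \<and> y K j = x"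
    and hor: "eventually (\<lambda>n. \<forall>i<K. \<forall>j\<le>K. d n (y i j n) (y (Suc i) j n) < e) \<omega>"
    and ver: "eventually (\<lambda>n. \<forall>i\<le>K. \<forall>j<K. d n (y i j n) (y i (Suc j) n) < e) \<omega>"
    by blast
  \<comment> \<open>From \<open>s n \<ge> 16\<close> it follows that \<open>2 ^ k n > 8\<close>, so
    that \<open>2 ^ k n / 8 + 1\<close> is below a quarter of \<open>2 ^ k n\<close>.\<close>
  have "eventually (\<lambda>n. s n \<ge> 16 \<and> (\<forall>i<K. \<forall>j\<le>K. d n (y i j n) (y (Suc i) j n) < e) \<and>
      (\<forall>i\<le>K. \<forall>j<K. d n (y i j n) (y i (Suc j) n) < e)) \<omega>"
    using s_large[of 16] hor ver by eventually_elim blast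
  then obtain n where sn: "s n \<ge> 16"
    and hor': "\<And>i j. i < K \<Longrightarrow> j \<le> K \<Longrightarrow> d n (y i j n) (y (Suc i) j n) < e"
    and ver': "\<And>i j. i \<le> K \<Longrightarrow> j < K \<Longrightarrow> d n (y i j n) (y i (Suc j) n) < e"
    using eventually_happens'[OF nontrivial] by blast
  have kn: "2 ^ k n \<le> s n" "s n < 2 * 2 ^ k n" using k[of n] sn by auto
  obtain path where path: "\<And>g h. g \<in> ?G \<Longrightarrow> h \<in> ?G \<Longrightarrow>
      h = g \<circ> tree_act (path g h) \<and> real (length (path g h)) \<le> C2 * ?dS g h"
    using C2(2) by metis
  have short: "4 * real (length (path g h)) \<le> 2 ^ k n" if "g \<in> ?G" "h \<in> ?G" "d n g h < e" for g h
  proof -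
    have "?dS g h \<le> e * s n" using that(3) s_pos[of n] by (simp add: d_def field_simps)
    then have "C2 * ?dS g h \<le> C2 * (e * s n)" using C2(1) by (intro mult_left_mono) auto
    also have "\<dots> = s n / 8" using C2(1) by (simp add: e_def)
    finally show ?thesis using path[OF that(1,2)] kn(2) by simp
  qed
  \<comment> \<open>Distance zero forces the empty word, so the constant sides of the grid carry no
    letters.\<close>
  have path_refl: "path g g = []" if "g \<in> ?G" for g
    using path[OF that that] dS(1)[OF that] by simp
  define q where "q i = nat \<lfloor>(real i / real K) * l n\<rfloor>" for i
  \<comment> \<open>The bottom labels are the actual pieces of the relator and not chosen paths, so
    that together they spell the relator itself.\<close>
  define H where "H i j = (if j = 0 then take (q (Suc i) - q i) (drop (q i) (relator (k n)))
      else path (y i j n) (y (Suc i) j n))" for i j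
  define V where "V i j = path (y i j n) (y i (Suc j) n)" for i j
  have Kpos: "real K > 0" using K by simp
  have H0: "H i 0 = piece (real i / real K) (real (Suc i) / real K) n" for i
    by (simp add: H_def piece_def q_def)
  have frac: "0 \<le> real i / real K" "real i / real K \<le> real (Suc i) / real K" for i
    using Kpos by (auto intro: divide_right_mono)
  have H: "y (Suc i) j n = y i j n \<circ> tree_act (H i j) \<and> 4 * real (length (H i j)) \<le> 2 ^ k n"
    if "i < K" "j \<le> K" for i j
  proof (cases "j = 0")
    case True
    have "real (length (H i 0)) \<le> l n * (real (Suc i) / real K - real i / real K) + 1"
      unfolding H0 by (rule length_piece[OF frac])
    also have "real (Suc i) / real K - real i / real K = 1 / real K"
      using Kpos by (simp add: field_simps)
    also have "l n * (1 / real K) \<le> l n * (1 / 64)"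
      using K l_pos[of n] by (intro mult_left_mono divide_left_mono) auto
    finally have "real (length (H i 0)) \<le> 2 ^ k n / 8 + 1" by (simp add: l_def)
    with True show ?thesis
      using \<gamma>_piece[OF frac, of i n] y0[of i] y0[of "Suc i"] that sn kn unfolding H0 True by simp
  next
    case False
    then show ?thesis using path[OF y y] short[OF y y hor'[OF that]] by (simp add: H_def)
  qed
  have V: "y i (Suc j) n = y i j n \<circ> tree_act (V i j) \<and> 4 * real (length (V i j)) \<le> 2 ^ k n"
    if "i \<le> K" "j < K" for i j
    using path[OF y y] short[OF y y ver'[OF that]] by (simp add: V_def)
  have "level_eq (k n) (concat (map (\<lambda>i. H i 0) [0..<K])) []"
  proof (rule level_eq_grid)
    fix i j assume ij: "i < K" "j < K"
    note HV = H[of i j] V[of "Suc i" j] V[of i j] H[of i "Suc j"]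
    have "y i j n \<circ> tree_act (H i j @ V (Suc i) j) = y (Suc i) (Suc j) n"
      using HV(1,2) ij by (simp add: fun_eq_iff)
    also have "\<dots> = y i j n \<circ> tree_act (V i j @ H i (Suc j))"
      using HV(3,4) ij by (simp add: fun_eq_iff)
    finally have "y i j n \<circ> tree_act (H i j @ V (Suc i) j) = y i j n \<circ> tree_act (V i j @ H i (Suc j))" .
    \<comment> \<open>Both routes around the square end at the same vertex; cancelling the common
      starting vertex leaves a relation.\<close>
    then have "tree_act (H i j @ V (Suc i) j) = tree_act (V i j @ H i (Suc j))"
      by (metis inv_comp_grigorchuk[OF y])
    moreover have "real (length (H i j @ V (Suc i) j) + length (V i j @ H i (Suc j))) \<le> real (2 ^ k n)"
      using HV ij by simp
    then have "length (H i j @ V (Suc i) j) + length (V i j @ H i (Suc j)) \<le> 2 ^ k n"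
      unfolding of_nat_le_iff .
    ultimately show "level_eq (k n) (H i j @ V (Suc i) j) (V i j @ H i (Suc j))"
      by (rule short_relation_level)
  next
    show "V 0 j = [] \<and> V K j = []" for j using y_sides path_refl x by (simp add: V_def)
    show "H i K = []" for i using yK path_refl x K by (simp add: H_def)
  qed
  moreover have "mono q"
  proof (rule monoI)
    fix i j :: nat assume "i \<le> j"
    then show "q i \<le> q j"
      unfolding q_def using Kpos l_pos[of n]
      by (intro nat_mono floor_mono mult_right_mono divide_right_mono) auto
  qed
  then have "concat (map (\<lambda>i. H i 0) [0..<K]) = take (q K) (relator (k n))"
    unfolding H_def by (simp add: concat_segments q_def[of 0])
  \<comment> \<open>The last cut point is the end of the relator, so the whole relator would act
    trivially on level \<open>k n\<close>.\<close>
  moreover have "q K = length (relator (k n))"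
    using Kpos by (simp add: q_def flip: l)
  ultimately show False using relator_level by simp
qed

theorem theorem1p4:
  "densely_related grigorchuk_group \<and>
   (\<forall>(\<omega> :: nat filter) S (x :: nat \<Rightarrow> bool list \<Rightarrow> bool list) (s :: nat \<Rightarrow> real).
      nonprincipal_ultrafilter \<omega> \<longrightarrow>
      finite_generating_set grigorchuk_group S \<longrightarrow>
      (\<forall>n. x n \<in> carrier grigorchuk_group) \<longrightarrow>
      (\<forall>n. s n > 0) \<longrightarrow> filterlim s at_top \<omega> \<longrightarrow>
      \<not> simply_connected_space (asymptotic_cone \<omega> grigorchuk_group S x s))"
  using densely_related_grigorchuk not_simply_connected_asymptotic_cone by blast

end
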